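(* Let $V$ be a real separable infinite-dimensional Hilbert space with orthonormal basis $(e_i)_{i\geq 0}$, let $J:V\to V\otimes V$ be any isometric linear isomorphism with $Je_0=e_0\otimes e_0$, and let $A_*$ be the 4-tensor with $(A_* )_{0000}=1$ and all other components $0$. There exist constants $C>0$ and $\delta_0>0$ such that for every 4-tensor $A$ with $A_{0000}=1$ and $\|A-A_*\|\leq \delta_0$ the following holds: there exist bounded invertible operators $G_h,G_v$ on $V$, a bounded invertible operator $R$ on $V\otimes V$, and Hilbert–Schmidt tensors $S_u,S_d$ satisfying the factorization condition of the type II step, such that, if $A^{(1)}$ is the gauge transform of $A$ by $(G_h,G_v)$, $A^{(2)}$ is the type I step applied to $A^{(1)}$ (with $J$), and $A^{(3)}$ is the type II step applied to $A^{(2)}$ (with $R,S_u,S_d,J$), then $A^{(3)}_{0000}\neq 0$ and the normalized tensor $A'=A^{(3)}/A^{(3)}_{0000}$ satisfies $A'_{0000}=1$ and $$\|A'-A_*\|\leq C\,\|A-A_*\|^{3/2}.$$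
   Context: A 4-tensor is an array $A=(A_{ijkl})_{i,j,k,l\geq 0}$ of real numbers with finite Hilbert–Schmidt norm $\|A\|=(\sum_{i,j,k,l}A_{ijkl}^2)^{1/2}$; the four indices belong to the right, top, left and bottom legs respectively. Tensors with other numbers of indices, or with indices ranging over the orthonormal basis $\{e_a\otimes e_b\}$ of $V\otimes V$ (indexed by pairs $(a,b)$), are defined analogously with Hilbert–Schmidt norms. Matrix entries of operators are taken in these bases, e.g. $J_{(ab),p}=\langle e_a\otimes e_b, Je_p\rangle$. Gauge transform by bounded invertible $G_h,G_v$ on $V$: $\tilde A_{ijkl}=\sum_{i',j',k',l'}(G_h)_{i'i}(G_v)_{j'j}(G_h^{-1})_{kk'}(G_v^{-1})_{ll'}A_{i'j'k'l'}$. Block tensor: for a 4-tensor $A$, $T$ is the 4-tensor with legs in $V\otimes V$ given by $T_{(i_1i_2),(j_1j_2),(k_1k_2),(l_1l_2)}=\sum_{a,b,c,d\geq 0}A_{a j_1 k_1 c}\,A_{i_1 j_2 a d}\,A_{b c k_2 l_1}\,A_{i_2 d b l_2}$ (four copies of $A$ in a $2\times 2$ block: top-left, top-right, bottom-left, bottom-right). Type I step: $A'_{pqrs}=\sum J_{(i_1i_2),p}J_{(j_1j_2),q}J_{(k_1k_2),r}J_{(l_1l_2),s}\,T_{(i_1i_2),(j_1j_2),(k_1k_2),(l_1l_2)}$. Type II step: given a bounded invertible $R$ on $V\otimes V$, set $S_{IjKl}=\sum_{I',K'}R_{I'I}\,T_{I'jK'l}\,(R^{-1})_{KK'}$ (capital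 indices range over the basis of $V\otimes V$ on the horizontal legs). Tensors $S_u=((S_u)_{a,(j_1j_2),c,m})$ and $S_d=((S_d)_{b,m,d,(l_1l_2)})$ (with $a,b,c,d,m,j_1,j_2,l_1,l_2\geq 0$) satisfy the factorization condition if $S_{(ab),(j_1j_2),(cd),(l_1l_2)}=\sum_{m\geq 0}(S_u)_{a,(j_1j_2),c,m}(S_d)_{b,m,d,(l_1l_2)}$ for all indices. Then $U_{(p_1p_2),m,(q_1q_2),m'}=\sum_{s,t}(S_d)_{p_1,m,q_1,(st)}(S_u)_{p_2,(st),q_2,m'}$ and the output is $A'_{ijkl}=\sum J_{(p_1p_2),i}J_{(q_1q_2),k}\,U_{(p_1p_2),j,(q_1q_2),l}$. *)

theory Defs
  imports "HOL-Analysis.Analysis"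
begin

text \<open>The Hilbert space V is realised as l2 over the index set nat (standard basis e_i);
  V tensor V is l2 over nat \<times> nat with basis e_a \<otimes> e_b indexed by (a,b).
  Bounded operators are represented by their matrices M i j = \<langle>e_i, M e_j\<rangle>.\<close>

definition is_l2 :: "('a \<Rightarrow> real) \<Rightarrow> bool" where
  "is_l2 x \<longleftrightarrow> (\<lambda>i. (x i)^2) summable_on UNIV"

definition l2norm :: "('a \<Rightarrow> real) \<Rightarrow> real" where
  "l2norm x = sqrt (\<Sum>\<^sub>\<infinity>i. (x i)^2)"

definition mat_apply :: "('b \<Rightarrow> 'a \<Rightarrow> real) \<Rightarrow> ('a \<Rightarrow> real) \<Rightarrow> ('b \<Rightarrow> real)" where
  "mat_apply M x = (\<lambda>i. \<Sum>\<^sub>\<infinity>j. M i j * x j)"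

definition bounded_mat :: "('b \<Rightarrow> 'a \<Rightarrow> real) \<Rightarrow> bool" where
  "bounded_mat M \<longleftrightarrow> (\<exists>B. \<forall>x. is_l2 x \<longrightarrow>
      (\<forall>i. (\<lambda>j. M i j * x j) summable_on UNIV) \<and> is_l2 (mat_apply M x) \<and>
      l2norm (mat_apply M x) \<le> B * l2norm x)"

definition bounded_inv_pair :: "('a \<Rightarrow> 'a \<Rightarrow> real) \<Rightarrow> ('a \<Rightarrow> 'a \<Rightarrow> real) \<Rightarrow> bool" where
  "bounded_inv_pair G Gi \<longleftrightarrow> bounded_mat G \<and> bounded_mat Gi \<and>
     (\<forall>x. is_l2 x \<longrightarrow> mat_apply G (mat_apply Gi x) = x \<and> mat_apply Gi (mat_apply G x) = x)"

text \<open>J : V \<rightarrow> V \<otimes> V is an isometric linear isomorphism (linearity is automatic for matrix action).\<close>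
definition isometric_iso :: "('b \<Rightarrow> 'a \<Rightarrow> real) \<Rightarrow> bool" where
  "isometric_iso J \<longleftrightarrow>
     (\<forall>x. is_l2 x \<longrightarrow> (\<forall>i. (\<lambda>j. J i j * x j) summable_on UNIV) \<and>
          is_l2 (mat_apply J x) \<and> l2norm (mat_apply J x) = l2norm x) \<and>
     (\<forall>y. is_l2 y \<longrightarrow> (\<exists>x. is_l2 x \<and> mat_apply J x = y))"

definition hs4 :: "('a \<Rightarrow> 'b \<Rightarrow> 'c \<Rightarrow> 'd \<Rightarrow> real) \<Rightarrow> bool" where
  "hs4 A \<longleftrightarrow> (\<lambda>(i,j,k,l). (A i j k l)^2) summable_on UNIV"

definition hsnorm4 :: "('a \<Rightarrow> 'b \<Rightarrow> 'c \<Rightarrow> 'd \<Rightarrow> real) \<Rightarrow> real" where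
  "hsnorm4 A = sqrt (\<Sum>\<^sub>\<infinity>(i,j,k,l). (A i j k l)^2)"

type_synonym tensor4 = "nat \<Rightarrow> nat \<Rightarrow> nat \<Rightarrow> nat \<Rightarrow> real"

definition Astar :: tensor4 where
  "Astar i j k l = (if i = 0 \<and> j = 0 \<and> k = 0 \<and> l = 0 then 1 else 0)"

definition tdiff :: "tensor4 \<Rightarrow> tensor4 \<Rightarrow> tensor4" where
  "tdiff A B = (\<lambda>i j k l. A i j k l - B i j k l)"

definition gauge :: "(nat \<Rightarrow> nat \<Rightarrow> real) \<Rightarrow> (nat \<Rightarrow> nat \<Rightarrow> real) \<Rightarrow>
    (nat \<Rightarrow> nat \<Rightarrow> real) \<Rightarrow> (nat \<Rightarrow> nat \<Rightarrow> real) \<Rightarrow> tensor4 \<Rightarrow> tensor4" where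
  "gauge Gh Ghi Gv Gvi A = (\<lambda>i j k l.
     \<Sum>\<^sub>\<infinity>(i',j',k',l'). Gh i' i * Gv j' j * Ghi k k' * Gvi l l' * A i' j' k' l')"

definition block :: "tensor4 \<Rightarrow> (nat\<times>nat) \<Rightarrow> (nat\<times>nat) \<Rightarrow> (nat\<times>nat) \<Rightarrow> (nat\<times>nat) \<Rightarrow> real" where
  "block A = (\<lambda>(i1,i2) (j1,j2) (k1,k2) (l1,l2).
     \<Sum>\<^sub>\<infinity>(a,b,c,d). A a j1 k1 c * A i1 j2 a d * A b c k2 l1 * A i2 d b l2)"

definition typeI :: "((nat\<times>nat) \<Rightarrow> nat \<Rightarrow> real) \<Rightarrow> tensor4 \<Rightarrow> tensor4" where
  "typeI J A = (\<lambda>p q r s.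
     \<Sum>\<^sub>\<infinity>(I,Q,K,L). J I p * J Q q * J K r * J L s * block A I Q K L)"

definition conjR :: "((nat\<times>nat) \<Rightarrow> (nat\<times>nat) \<Rightarrow> real) \<Rightarrow> ((nat\<times>nat) \<Rightarrow> (nat\<times>nat) \<Rightarrow> real) \<Rightarrow>
    ((nat\<times>nat) \<Rightarrow> (nat\<times>nat) \<Rightarrow> (nat\<times>nat) \<Rightarrow> (nat\<times>nat) \<Rightarrow> real) \<Rightarrow>
    ((nat\<times>nat) \<Rightarrow> (nat\<times>nat) \<Rightarrow> (nat\<times>nat) \<Rightarrow> (nat\<times>nat) \<Rightarrow> real)" where
  "conjR R Ri T = (\<lambda>I j K l. \<Sum>\<^sub>\<infinity>(I',K'). R I' I * T I' j K' l * Ri K K')"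

definition factor_cond :: "((nat\<times>nat) \<Rightarrow> (nat\<times>nat) \<Rightarrow> (nat\<times>nat) \<Rightarrow> (nat\<times>nat) \<Rightarrow> real) \<Rightarrow>
    (nat \<Rightarrow> (nat\<times>nat) \<Rightarrow> nat \<Rightarrow> nat \<Rightarrow> real) \<Rightarrow> (nat \<Rightarrow> nat \<Rightarrow> nat \<Rightarrow> (nat\<times>nat) \<Rightarrow> real) \<Rightarrow> bool" where
  "factor_cond S Su Sd \<longleftrightarrow> (\<forall>a b j c d l.
     S (a,b) j (c,d) l = (\<Sum>\<^sub>\<infinity>m. Su a j c m * Sd b m d l))"

definition Umat :: "(nat \<Rightarrow> (nat\<times>nat) \<Rightarrow> nat \<Rightarrow> nat \<Rightarrow> real) \<Rightarrow> (nat \<Rightarrow> nat \<Rightarrow> nat \<Rightarrow> (nat\<times>nat) \<Rightarrow> real) \<Rightarrow>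
    (nat\<times>nat) \<Rightarrow> nat \<Rightarrow> (nat\<times>nat) \<Rightarrow> nat \<Rightarrow> real" where
  "Umat Su Sd = (\<lambda>(p1,p2) m (q1,q2) m'. \<Sum>\<^sub>\<infinity>(s,t). Sd p1 m q1 (s,t) * Su p2 (s,t) q2 m')"

definition typeII :: "((nat\<times>nat) \<Rightarrow> nat \<Rightarrow> real) \<Rightarrow> (nat \<Rightarrow> (nat\<times>nat) \<Rightarrow> nat \<Rightarrow> nat \<Rightarrow> real) \<Rightarrow>
    (nat \<Rightarrow> nat \<Rightarrow> nat \<Rightarrow> (nat\<times>nat) \<Rightarrow> real) \<Rightarrow> tensor4" where
  "typeII J Su Sd = (\<lambda>i j k l. \<Sum>\<^sub>\<infinity>(P,Q). J P i * J Q k * Umat Su Sd P j Q l)"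

end

theory Submission
  imports Defs "HOL-Library.Function_Algebras"
begin

text \<open>
  Write the tensor as \<open>A = A\<^sub>* + B\<close> and let \<open>t\<close> be the Hilbert--Schmidt norm of \<open>B\<close>.
  In a \<open>2 \<times> 2\<close> block the internal legs of a term linear in \<open>B\<close> all vanish, so to first order only the
  entries of \<open>B\<close> with at most two adjacent nonzero legs survive a type I step. A horizontal gauge
  transform removes the entries whose only nonzero leg is horizontal; then, up to \<open>O(t\<^sup>2)\<close>, every
  entry left after the type I step has exactly one nonzero vertical leg and at most one nonzero
  horizontal leg.

  Cut the second block horizontally into an upper and a lower row. Up to \<open>O(t\<^sup>3)\<close>, the terms in which
  the cut legs are nonzero connect the two left external legs, or the two right ones, with each
  other and with nothing else. These \<open>O(t\<^sup>2)\<close> terms are what the disentangler cancels, so that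
  the block becomes a product of its two rows plus a remainder of nuclear norm \<open>O(t\<^sup>3)\<close>. Splitting
  the remainder evenly puts \<open>O(t\<^bsup>3/2\<^esup>)\<close> into either factor, which is where the exponent comes from. When
  the two factors are glued in the opposite order, the \<open>O(t)\<close> entries of each meet only
  those of the other, and contribute \<open>O(t\<^sup>2)\<close>.

  The vertical gauge can be taken trivial: entries whose only nonzero leg is vertical are
  harmless, as vertical legs are contracted in pairs in the type II step.
\<close>

section \<open>Square-summable families\<close>

text \<open>The bound is imposed on finite partial sums, so estimates reduce to finite
  Cauchy-Schwarz and Minkowski inequalities, and one predicate carries both summability and the norm
  bound (\<open>l2_le_iff\<close>).\<close>

definition l2_le :: "('a \<Rightarrow> real) \<Rightarrow> real \<Rightarrow> bool" where
  "l2_le f c \<longleftrightarrow> (\<forall>F. finite F \<longrightarrow> L2_set f F \<le> c)"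

lemma l2_leD: "l2_le f c \<Longrightarrow> finite F \<Longrightarrow> L2_set f F \<le> c"
  by (simp add: l2_le_def)

lemma l2_le_nonneg: "l2_le f c \<Longrightarrow> 0 \<le> c"
  using l2_leD[of f c "{}"] by simp

lemma l2_leD_sq: "l2_le f c \<Longrightarrow> finite F \<Longrightarrow> (\<Sum>x\<in>F. (f x)\<^sup>2) \<le> c\<^sup>2"
  using l2_leD[of f c F] by (simp add: L2_set_def sqrt_le_D)

lemma l2_leI_sq:
  assumes "0 \<le> c" "\<And>F. finite F \<Longrightarrow> (\<Sum>x\<in>F. (f x)\<^sup>2) \<le> c\<^sup>2"
  shows "l2_le f c"
  unfolding l2_le_def L2_set_def using assms by (simp add: real_le_lsqrt sum_nonneg)

lemma l2_le_summable_sq: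
  assumes "l2_le f c" shows "(\<lambda>x. (f x)\<^sup>2) summable_on UNIV"
  by (rule nonneg_bdd_above_summable_on) (use l2_leD_sq[OF assms] in \<open>auto intro!: bdd_aboveI2[where M = "c\<^sup>2"]\<close>)

lemma l2_le_iff: "l2_le f c \<longleftrightarrow> is_l2 f \<and> l2norm f \<le> c"
proof
  assume f: "l2_le f c"
  have s: "is_l2 f" unfolding is_l2_def by (rule l2_le_summable_sq[OF f])
  have "(\<Sum>\<^sub>\<infinity>i. (f i)\<^sup>2) \<le> c\<^sup>2"
    by (rule infsum_le_finite_sums) (use s l2_leD_sq[OF f] in \<open>auto simp: is_l2_def\<close>)
  then have "l2norm f \<le> c"
    unfolding l2norm_def by (intro real_le_lsqrt infsum_nonneg) (auto simp: l2_le_nonneg[OF f])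
  then show "is_l2 f \<and> l2norm f \<le> c" using s by simp
next
  assume a: "is_l2 f \<and> l2norm f \<le> c"
  show "l2_le f c"
    unfolding l2_le_def
  proof (intro allI impI)
    fix F :: "'a set" assume "finite F"
    then have "(\<Sum>x\<in>F. (f x)\<^sup>2) \<le> (\<Sum>\<^sub>\<infinity>i. (f i)\<^sup>2)"
      using a by (intro finite_sum_le_infsum) (auto simp: is_l2_def)
    then have "L2_set f F \<le> l2norm f"
      unfolding L2_set_def l2norm_def by simp
    then show "L2_set f F \<le> c" using a by simp
  qed
qed

lemma l2_le_mono: "l2_le f c \<Longrightarrow> c \<le> d \<Longrightarrow> l2_le f d"
  unfolding l2_le_def by (meson order_trans)

lemma l2_le_zero: "0 \<le> c \<Longrightarrow> l2_le (\<lambda>_. 0) c"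
  by (simp add: l2_le_def L2_set_def)

lemma l2_le_add:
  assumes "l2_le f a" "l2_le g b" shows "l2_le (\<lambda>x. f x + g x) (a + b)"
  unfolding l2_le_def
proof (intro allI impI)
  fix F :: "'a set" assume "finite F"
  then show "L2_set (\<lambda>x. f x + g x) F \<le> a + b"
    using L2_set_triangle_ineq[of f g F] l2_leD[OF assms(1)] l2_leD[OF assms(2)] by fastforce
qed

lemma l2_le_scale:
  assumes "l2_le f a" shows "l2_le (\<lambda>x. k * f x) (\<bar>k\<bar> * a)"
proof (rule l2_leI_sq)
  show "0 \<le> \<bar>k\<bar> * a" using l2_le_nonneg[OF assms] by simp
  fix F :: "'a set" assume "finite F"
  have "(\<Sum>x\<in>F. (k * f x)\<^sup>2) = k\<^sup>2 * (\<Sum>x\<in>F. (f x)\<^sup>2)"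
    by (simp add: sum_distrib_left power_mult_distrib)
  also have "\<dots> \<le> k\<^sup>2 * a\<^sup>2" by (intro mult_left_mono l2_leD_sq[OF assms] \<open>finite F\<close>) auto
  finally show "(\<Sum>x\<in>F. (k * f x)\<^sup>2) \<le> (\<bar>k\<bar> * a)\<^sup>2" by (simp add: power_mult_distrib)
qed

text \<open>The device behind nearly every later reindexing: slicing, permuting legs, restricting
  and padding by zeros. Injectivity is asked only on the support of \<open>g\<close>, which is what
  allows padding.\<close>

lemma l2_le_pullback:
  assumes f: "l2_le f c" and inj: "inj_on h {y. g y \<noteq> 0}"
    and le: "\<And>y. g y \<noteq> 0 \<Longrightarrow> \<bar>g y\<bar> \<le> \<bar>f (h y)\<bar>"
  shows "l2_le g c"
proof (rule l2_leI_sq)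
  show "0 \<le> c" using l2_le_nonneg[OF f] .
  fix F :: "'b set" assume F: "finite F"
  let ?F = "{y\<in>F. g y \<noteq> 0}"
  have "(\<Sum>y\<in>F. (g y)\<^sup>2) = (\<Sum>y\<in>?F. (g y)\<^sup>2)"
    using F by (intro sum.mono_neutral_right) auto
  also have "\<dots> \<le> (\<Sum>y\<in>?F. (f (h y))\<^sup>2)"
    by (intro sum_mono) (use le in \<open>auto simp: abs_le_square_iff\<close>)
  also have "\<dots> = (\<Sum>x\<in>h ` ?F. (f x)\<^sup>2)"
    by (subst sum.reindex) (auto intro: inj_on_subset[OF inj])
  also have "\<dots> \<le> c\<^sup>2" using F by (intro l2_leD_sq[OF f]) auto
  finally show "(\<Sum>y\<in>F. (g y)\<^sup>2) \<le> c\<^sup>2" .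
qed

lemma l2_le_entry: assumes "l2_le f c" shows "\<bar>f x\<bar> \<le> c"
  using l2_leD[OF assms, of "{x}"] by (simp add: L2_set_def)

lemma l2_le_mult_abs_summable:
  assumes "l2_le f a" "l2_le g b"
  shows "(\<lambda>x. \<bar>f x * g x\<bar>) summable_on UNIV" "(\<Sum>\<^sub>\<infinity>x. \<bar>f x * g x\<bar>) \<le> a * b"
proof -
  have *: "(\<Sum>x\<in>F. \<bar>f x * g x\<bar>) \<le> a * b" if "finite F" for F
  proof -
    have "(\<Sum>x\<in>F. \<bar>f x * g x\<bar>) \<le> L2_set f F * L2_set g F"
      using L2_set_mult_ineq[of f g F] by (simp add: abs_mult)
    also have "\<dots> \<le> a * b"
      using that assms by (intro mult_mono l2_leD) (auto simp: l2_le_nonneg)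
    finally show ?thesis .
  qed
  show 1: "(\<lambda>x. \<bar>f x * g x\<bar>) summable_on UNIV"
    by (rule nonneg_bdd_above_summable_on) (use * in \<open>auto intro!: bdd_aboveI2[where M = "a*b"]\<close>)
  show "(\<Sum>\<^sub>\<infinity>x. \<bar>f x * g x\<bar>) \<le> a * b"
    by (rule infsum_le_finite_sums[OF 1]) (use * in auto)
qed

lemma l2_le_mult_summable:
  assumes "l2_le f a" "l2_le g b" shows "(\<lambda>x. f x * g x) summable_on UNIV"
  by (rule abs_summable_summable) (use l2_le_mult_abs_summable(1)[OF assms] in simp)

lemma l2_le_inner_le:
  assumes "l2_le f a" "l2_le g b" shows "\<bar>\<Sum>\<^sub>\<infinity>x. f x * g x\<bar> \<le> a * b"
  using norm_infsum_bound[of "\<lambda>x. f x * g x" UNIV] l2_le_mult_abs_summable[OF assms] by simp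

lemma l2_le_tensor:
  assumes "l2_le f a" "l2_le g b"
  shows "l2_le (\<lambda>(x, y). f x * g y) (a * b)"
proof (rule l2_leI_sq)
  show "0 \<le> a * b" using assms l2_le_nonneg by (metis mult_nonneg_nonneg)
  fix F :: "('a \<times> 'b) set" assume F: "finite F"
  have "(\<Sum>z\<in>F. (case z of (x, y) \<Rightarrow> f x * g y)\<^sup>2)
      \<le> (\<Sum>z\<in>fst ` F \<times> snd ` F. (case z of (x, y) \<Rightarrow> f x * g y)\<^sup>2)"
    using F by (intro sum_mono2) (simp_all add: subset_fst_snd)
  also have "\<dots> = (\<Sum>x\<in>fst ` F. (f x)\<^sup>2) * (\<Sum>y\<in>snd ` F. (g y)\<^sup>2)"
    by (simp add: sum_product sum.cartesian_product power_mult_distrib split_def)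
  also have "\<dots> \<le> a\<^sup>2 * b\<^sup>2"
    using F by (intro mult_mono l2_leD_sq[OF assms(1)] l2_leD_sq[OF assms(2)] sum_nonneg) auto
  finally show "(\<Sum>z\<in>F. (case z of (x, y) \<Rightarrow> f x * g y)\<^sup>2) \<le> (a * b)\<^sup>2"
    by (simp add: power_mult_distrib)
qed

lemma l2_le_slice: "l2_le (\<lambda>(x, y). f x y) c \<Longrightarrow> l2_le (f x) c"
  by (erule l2_le_pullback[where h = "Pair x"]) (auto simp: inj_on_def)

lemma l2_le_slice_norm:
  assumes "is_l2 f" shows "l2_le f (l2norm f)"
  using assms by (simp add: l2_le_iff)

lemma has_sum_sum:
  fixes f :: "'i \<Rightarrow> 'a \<Rightarrow> real"
  assumes "finite I" "\<And>i. i \<in> I \<Longrightarrow> (f i has_sum s i) A"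
  shows "((\<lambda>x. \<Sum>i\<in>I. f i x) has_sum (\<Sum>i\<in>I. s i)) A"
  using assms by (induction I) (auto intro!: has_sum_add)

text \<open>For finitely many \<open>x\<close> the inner infinite sums add up to one infinite sum
  over \<open>y\<close>; its partial sums run over finite rectangles, where the bound on
  \<open>f\<close> applies.\<close>

lemma l2_le_l2norm_slices:
  assumes f: "l2_le (\<lambda>(x, y). f x y) c"
  shows "l2_le (\<lambda>x. l2norm (f x)) c"
proof (rule l2_leI_sq)
  show "0 \<le> c" using l2_le_nonneg[OF f] .
  fix X :: "'a set" assume X: "finite X"
  have sq: "(l2norm (f x))\<^sup>2 = (\<Sum>\<^sub>\<infinity>y. (f x y)\<^sup>2)" for x
    unfolding l2norm_def by (simp add: infsum_nonneg)
  have sum: "(\<lambda>y. (f x y)\<^sup>2) summable_on UNIV" for x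
    by (rule l2_le_summable_sq[OF l2_le_slice[OF f]])
  have "((\<lambda>y. \<Sum>x\<in>X. (f x y)\<^sup>2) has_sum (\<Sum>x\<in>X. (l2norm (f x))\<^sup>2)) UNIV"
    unfolding sq by (intro has_sum_sum has_sum_infsum sum X)
  moreover have "(\<Sum>y\<in>Y. \<Sum>x\<in>X. (f x y)\<^sup>2) \<le> c\<^sup>2" if "finite Y" for Y
  proof -
    have "(\<Sum>y\<in>Y. \<Sum>x\<in>X. (f x y)\<^sup>2) = (\<Sum>z\<in>X \<times> Y. (case z of (x, y) \<Rightarrow> f x y)\<^sup>2)"
      by (subst sum.swap) (simp add: sum.cartesian_product split_def)
    also have "\<dots> \<le> c\<^sup>2" by (rule l2_leD_sq[OF f]) (use X that in auto)
    finally show ?thesis .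
  qed
  ultimately show "(\<Sum>x\<in>X. (l2norm (f x))\<^sup>2) \<le> c\<^sup>2"
    by (rule has_sum_le_finite_sums)
qed

text \<open>Cauchy-Schwarz over \<open>m\<close> dominates each entry by a product of slice norms,
  which is a tensor product of two square-summable families. This is submultiplicativity of the
  Hilbert-Schmidt norm.\<close>

lemma l2_le_contract:
  assumes f: "l2_le (\<lambda>(x, m). f x m) a" and g: "l2_le (\<lambda>(y, m). g y m) b"
  shows "l2_le (\<lambda>(x, y). \<Sum>\<^sub>\<infinity>m. f x m * g y m) (a * b)"
proof (rule l2_le_pullback[OF l2_le_tensor[OF l2_le_l2norm_slices[OF f] l2_le_l2norm_slices[OF g]], where h = id])
  have l: "is_l2 (f x)" "is_l2 (g y)" for x y
    using l2_le_slice[OF f] l2_le_slice[OF g] by (auto simp: l2_le_iff)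
  have n: "0 \<le> l2norm (f x) * l2norm (g y)" for x y
    by (simp add: l2norm_def infsum_nonneg)
  show "\<bar>case z of (x, y) \<Rightarrow> \<Sum>\<^sub>\<infinity>m. f x m * g y m\<bar> \<le> \<bar>case id z of (x, y) \<Rightarrow> l2norm (f x) * l2norm (g y)\<bar>"
    for z
  proof (cases z)
    case (Pair x y)
    show ?thesis unfolding Pair id_def prod.case abs_of_nonneg[OF n]
      by (rule l2_le_inner_le[OF l2_le_slice_norm[OF l(1)] l2_le_slice_norm[OF l(2)]])
  qed
qed simp

section \<open>Infinite sums over products and the contraction of a square\<close>

lemma infsum_single:
  fixes f :: "'a \<Rightarrow> real"
  assumes "\<And>x. x \<noteq> z \<Longrightarrow> f x = 0" shows "(\<Sum>\<^sub>\<infinity>x. f x) = f z"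
  using infsum_cong_neutral[of "{z}" UNIV f f] assms by auto

lemma infsum_prod_eq:
  fixes f :: "'a \<Rightarrow> 'b \<Rightarrow> real"
  assumes "(\<lambda>(x, y). f x y) summable_on UNIV"
  shows "(\<Sum>\<^sub>\<infinity>(x, y). f x y) = (\<Sum>\<^sub>\<infinity>x. \<Sum>\<^sub>\<infinity>y. f x y)"
  using infsum_Sigma'_banach[of f UNIV "\<lambda>_. UNIV"] assms by simp

lemma infsum_swap_UNIV:
  fixes f :: "'a \<Rightarrow> 'b \<Rightarrow> real"
  assumes "(\<lambda>(x, y). f x y) summable_on UNIV"
  shows "(\<Sum>\<^sub>\<infinity>x. \<Sum>\<^sub>\<infinity>y. f x y) = (\<Sum>\<^sub>\<infinity>y. \<Sum>\<^sub>\<infinity>x. f x y)"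
  using infsum_swap_banach[of f UNIV UNIV] assms by simp

lemma infsum_prod_mult:
  fixes f :: "'a \<Rightarrow> real" and g :: "'b \<Rightarrow> real"
  assumes "(\<lambda>(x, y). f x * g y) summable_on UNIV"
  shows "(\<Sum>\<^sub>\<infinity>(x, y). f x * g y) = (\<Sum>\<^sub>\<infinity>x. f x) * (\<Sum>\<^sub>\<infinity>y. g y)"
  by (subst infsum_prod_eq[OF assms]) (simp add: infsum_cmult_right' infsum_cmult_left')

text \<open>Absolute convergence: pairing the two opposite sides of the square turns the quadruple
  product into a product of two square-summable families.\<close>
lemma square_summable:
  assumes x: "l2_le (\<lambda>(a, c). x a c) kx" and y: "l2_le (\<lambda>(a, d). y a d) ky"
    and z: "l2_le (\<lambda>(b, c). z b c) kz" and w: "l2_le (\<lambda>(b, d). w b d) kw"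
  shows "(\<lambda>((a, b), (c, d)). x a c * y a d * z b c * w b d) summable_on UNIV"
proof -
  have 1: "l2_le (\<lambda>((a, b), (c, d)). x a c * w b d) (kx * kw)"
    by (rule l2_le_pullback[OF l2_le_tensor[OF x w], where h = "\<lambda>((a, b), (c, d)). ((a, c), (b, d))"])
       (auto simp: inj_on_def)
  have 2: "l2_le (\<lambda>((a, b), (c, d)). y a d * z b c) (ky * kz)"
    by (rule l2_le_pullback[OF l2_le_tensor[OF y z], where h = "\<lambda>((a, b), (c, d)). ((a, d), (b, c))"])
       (auto simp: inj_on_def)
  show ?thesis
    by (rule summable_on_cong[THEN iffD1, OF _ l2_le_mult_summable[OF 1 2]]) (auto simp: algebra_simps)
qed

text \<open>Fubini for a plaquette: contracting one pair of opposite bonds first, or the other,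
  gives the same absolutely convergent sum over all four bonds.\<close>

lemma square_infsum:
  assumes x: "l2_le (\<lambda>(a, c). x a c) kx" and y: "l2_le (\<lambda>(a, d). y a d) ky"
    and z: "l2_le (\<lambda>(b, c). z b c) kz" and w: "l2_le (\<lambda>(b, d). w b d) kw"
  shows "(\<Sum>\<^sub>\<infinity>(c, d). (\<Sum>\<^sub>\<infinity>a. x a c * y a d) * (\<Sum>\<^sub>\<infinity>b. z b c * w b d))
         = (\<Sum>\<^sub>\<infinity>((a, b), (c, d)). x a c * y a d * z b c * w b d)" (is "?L = ?M")
    and "(\<Sum>\<^sub>\<infinity>(a, b). (\<Sum>\<^sub>\<infinity>c. x a c * z b c) * (\<Sum>\<^sub>\<infinity>d. y a d * w b d))
         = (\<Sum>\<^sub>\<infinity>((a, b), (c, d)). x a c * y a d * z b c * w b d)" (is "?R = ?M")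
proof -
  let ?f = "\<lambda>(a, b) (c, d). x a c * y a d * z b c * w b d"
  have s: "(\<lambda>(p, q). ?f p q) summable_on UNIV"
    using square_summable[OF assms] by (simp add: split_def)
  have s': "(\<lambda>(q, p). ?f p q) summable_on UNIV"
    using s summable_on_swap[of "\<lambda>(p, q). ?f p q" UNIV UNIV] by (simp add: split_def)
  have M: "?M = (\<Sum>\<^sub>\<infinity>p. \<Sum>\<^sub>\<infinity>q. ?f p q)"
    using infsum_prod_eq[OF s] by (simp add: split_def)
  have s1: "(\<lambda>(c, d). ?f p (c, d)) summable_on UNIV" for p
    using summable_on_SigmaD1[of ?f UNIV "\<lambda>_. UNIV" p] s by (simp add: split_def)
  have s2: "(\<lambda>(a, b). ?f (a, b) q) summable_on UNIV" for q
    using summable_on_SigmaD1[of "\<lambda>q p. ?f p q" UNIV "\<lambda>_. UNIV" q] s' by (simp add: split_def)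
  have R: "(\<Sum>\<^sub>\<infinity>q. ?f (a, b) q) = (\<Sum>\<^sub>\<infinity>c. x a c * z b c) * (\<Sum>\<^sub>\<infinity>d. y a d * w b d)" for a b
    using infsum_prod_mult[of "\<lambda>c. x a c * z b c" "\<lambda>d. y a d * w b d"] s1[of "(a, b)"]
    by (simp add: split_def mult_ac)
  have L: "(\<Sum>\<^sub>\<infinity>p. ?f p (c, d)) = (\<Sum>\<^sub>\<infinity>a. x a c * y a d) * (\<Sum>\<^sub>\<infinity>b. z b c * w b d)" for c d
    using infsum_prod_mult[of "\<lambda>a. x a c * y a d" "\<lambda>b. z b c * w b d"] s2[of "(c, d)"]
    by (simp add: split_def mult_ac)
  show "?R = ?M" unfolding M by (rule infsum_cong) (simp add: R[symmetric] split: prod.split)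
  have "?L = (\<Sum>\<^sub>\<infinity>q. \<Sum>\<^sub>\<infinity>p. ?f p q)"
    by (rule infsum_cong) (simp add: L[symmetric] split: prod.split)
  then show "?L = ?M" unfolding M using infsum_swap_UNIV[OF s] by simp
qed

section \<open>Hilbert--Schmidt tensors and their contractions\<close>

type_synonym ('a, 'b, 'c, 'd) tensor = "'a \<Rightarrow> 'b \<Rightarrow> 'c \<Rightarrow> 'd \<Rightarrow> real"

definition hs_le :: "('a, 'b, 'c, 'd) tensor \<Rightarrow> real \<Rightarrow> bool" where
  "hs_le X c \<longleftrightarrow> l2_le (\<lambda>(i, j, k, l). X i j k l) c"

text \<open>\<open>Astar\<close> for arbitrary leg types. On a leg in the tensor square the zero
  index is \<open>(0, 0)\<close>, so the same formula also describes the vacuum of blocks and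
  rows.\<close>

definition unit4 :: "('a::zero, 'b::zero, 'c::zero, 'd::zero) tensor" where
  "unit4 i j k l = (if i = 0 \<and> j = 0 \<and> k = 0 \<and> l = 0 then 1 else 0)"

definition scale4 :: "real \<Rightarrow> ('a, 'b, 'c, 'd) tensor \<Rightarrow> ('a, 'b, 'c, 'd) tensor" where
  "scale4 s X = (\<lambda>i j k l. s * X i j k l)"

text \<open>\<open>X\<close> stands to the left of \<open>Y\<close>: the right leg of
  \<open>X\<close> is joined to the left leg of \<open>Y\<close>, and the vertical legs are paired
  from left to right. In \<open>vcon\<close> below, \<open>X\<close> stands above
  \<open>Y\<close>.\<close>

definition hcon :: "('a, 'b, 'c, 'd) tensor \<Rightarrow> ('e, 'f, 'a, 'g) tensor \<Rightarrow> ('e, 'b \<times> 'f, 'c, 'd \<times> 'g) tensor" where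
  "hcon X Y = (\<lambda>i j k l. \<Sum>\<^sub>\<infinity>a. X a (fst j) k (fst l) * Y i (snd j) a (snd l))"

definition vcon :: "('a, 'b, 'c, 'm) tensor \<Rightarrow> ('e, 'm, 'f, 'g) tensor \<Rightarrow> ('a \<times> 'e, 'b, 'c \<times> 'f, 'g) tensor" where
  "vcon X Y = (\<lambda>i j k l. \<Sum>\<^sub>\<infinity>m. X (fst i) j (fst k) m * Y (snd i) m (snd k) l)"

lemma hs_le_nonneg: "hs_le X c \<Longrightarrow> 0 \<le> c"
  unfolding hs_le_def by (rule l2_le_nonneg)

lemma hs_le_mono: "hs_le X c \<Longrightarrow> c \<le> d \<Longrightarrow> hs_le X d"
  unfolding hs_le_def by (rule l2_le_mono)

lemma hs_le_add: "hs_le X a \<Longrightarrow> hs_le Y b \<Longrightarrow> hs_le (X + Y) (a + b)"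
  unfolding hs_le_def by (drule (1) l2_le_add) (simp add: split_def)

lemma hs_le_scale: "hs_le X a \<Longrightarrow> hs_le (scale4 s X) (\<bar>s\<bar> * a)"
  unfolding hs_le_def scale4_def by (drule l2_le_scale[of _ _ s]) (simp add: split_def)

lemma hs_le_uminus: "hs_le X a \<Longrightarrow> hs_le (- X) a"
  using hs_le_scale[of X a "-1"] by (simp add: scale4_def fun_Compl_def)

lemma hs_le_diff: "hs_le X a \<Longrightarrow> hs_le Y b \<Longrightarrow> hs_le (X - Y) (a + b)"
  using hs_le_add[OF _ hs_le_uminus, of X a Y b] by simp

lemma hs_le_zero: "0 \<le> c \<Longrightarrow> hs_le 0 c"
  unfolding hs_le_def using l2_le_zero[of c] by (simp add: split_def)

lemma hs_le_entry: "hs_le X c \<Longrightarrow> \<bar>X i j k l\<bar> \<le> c"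
  unfolding hs_le_def by (drule l2_le_entry[of _ _ "(i, j, k, l)"]) simp

lemma hs_le_pullback:
  assumes "hs_le X c" "inj_on h {(i, j, k, l). Y i j k l \<noteq> 0}"
    and "\<And>i j k l. Y i j k l \<noteq> 0 \<Longrightarrow> \<bar>Y i j k l\<bar> \<le> \<bar>case h (i, j, k, l) of (i', j', k', l') \<Rightarrow> X i' j' k' l'\<bar>"
  shows "hs_le Y c"
  unfolding hs_le_def
  by (rule l2_le_pullback[OF assms(1)[unfolded hs_le_def], of h]) (use assms(2,3) in \<open>auto simp: split_def\<close>)

lemma hs_le_le: "hs_le X c \<Longrightarrow> (\<And>i j k l. \<bar>Y i j k l\<bar> \<le> \<bar>X i j k l\<bar>) \<Longrightarrow> hs_le Y c"
  by (rule hs_le_pullback[where h = id]) auto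

lemma hs_le_unit: "hs_le unit4 1"
proof -
  have "l2_le (\<lambda>x::unit. 1) 1"
    by (auto intro!: l2_leI_sq simp: card_le_Suc0_iff_eq)
  then show ?thesis unfolding hs_le_def unit4_def
    by (rule l2_le_pullback[where h = "\<lambda>_. ()"]) (auto simp: inj_on_def split: if_splits)
qed

lemma hs_le_slice:
  assumes "hs_le X c" "inj h" "\<And>y. f y = (case h y of (i, j, k, l) \<Rightarrow> X i j k l)"
  shows "l2_le f c"
  by (rule l2_le_pullback[OF assms(1)[unfolded hs_le_def], of h])
     (use assms(2,3) in \<open>auto simp: split_def intro: inj_on_subset\<close>)

lemma hs_le_slices:
  assumes "hs_le X c"
  shows "l2_le (\<lambda>i. X i j k l) c" "l2_le (\<lambda>j. X i j k l) c" "l2_le (\<lambda>k. X i j k l) c" "l2_le (\<lambda>l. X i j k l) c"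
    "l2_le (\<lambda>(i, j). X i j k l) c" "l2_le (\<lambda>(i, k). X i j k l) c" "l2_le (\<lambda>(i, l). X i j k l) c"
    "l2_le (\<lambda>(k, j). X i j k l) c" "l2_le (\<lambda>(k, l). X i j k l) c"
proof -
  show "l2_le (\<lambda>i. X i j k l) c"
    by (rule hs_le_slice[OF assms, of "\<lambda>i. (i, j, k, l)"]) (auto simp: inj_def)
  show "l2_le (\<lambda>j. X i j k l) c"
    by (rule hs_le_slice[OF assms, of "\<lambda>j. (i, j, k, l)"]) (auto simp: inj_def)
  show "l2_le (\<lambda>k. X i j k l) c"
    by (rule hs_le_slice[OF assms, of "\<lambda>k. (i, j, k, l)"]) (auto simp: inj_def)
  show "l2_le (\<lambda>l. X i j k l) c"
    by (rule hs_le_slice[OF assms, of "\<lambda>l. (i, j, k, l)"]) (auto simp: inj_def)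
  show "l2_le (\<lambda>(i, j). X i j k l) c"
    by (rule hs_le_slice[OF assms, of "\<lambda>(i, j). (i, j, k, l)"]) (auto simp: inj_def)
  show "l2_le (\<lambda>(i, k). X i j k l) c"
    by (rule hs_le_slice[OF assms, of "\<lambda>(i, k). (i, j, k, l)"]) (auto simp: inj_def)
  show "l2_le (\<lambda>(i, l). X i j k l) c"
    by (rule hs_le_slice[OF assms, of "\<lambda>(i, l). (i, j, k, l)"]) (auto simp: inj_def)
  show "l2_le (\<lambda>(k, j). X i j k l) c"
    by (rule hs_le_slice[OF assms, of "\<lambda>(k, j). (i, j, k, l)"]) (auto simp: inj_def)
  show "l2_le (\<lambda>(k, l). X i j k l) c"
    by (rule hs_le_slice[OF assms, of "\<lambda>(k, l). (i, j, k, l)"]) (auto simp: inj_def)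
qed

lemma hcon_summable:
  "hs_le X a \<Longrightarrow> hs_le Y b \<Longrightarrow> (\<lambda>a. X a j k l * Y i j' a l') summable_on UNIV"
  by (rule l2_le_mult_summable[OF hs_le_slices(1) hs_le_slices(3)])

lemma vcon_summable:
  "hs_le X a \<Longrightarrow> hs_le Y b \<Longrightarrow> (\<lambda>m. X i j k m * Y i' m k' l) summable_on UNIV"
  by (rule l2_le_mult_summable[OF hs_le_slices(4) hs_le_slices(2)])

lemma hs_le_hcon:
  assumes "hs_le X a" "hs_le Y b" shows "hs_le (hcon X Y) (a * b)"
proof -
  have x: "l2_le (\<lambda>((j, k, l), m). X m j k l) a"
    by (rule l2_le_pullback[OF assms(1)[unfolded hs_le_def], of "\<lambda>((j, k, l), m). (m, j, k, l)"])
       (auto simp: inj_on_def)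
  have y: "l2_le (\<lambda>((i, j, l), m). Y i j m l) b"
    by (rule l2_le_pullback[OF assms(2)[unfolded hs_le_def], of "\<lambda>((i, j, l), m). (i, j, m, l)"])
       (auto simp: inj_on_def)
  show ?thesis unfolding hs_le_def hcon_def
    by (rule l2_le_pullback[OF l2_le_contract[of "\<lambda>(j, k, l) m. X m j k l" a "\<lambda>(i, j, l) m. Y i j m l" b],
            of "\<lambda>(i, j, k, l). ((fst j, k, fst l), (i, snd j, snd l))"])
       (use x y in \<open>auto simp: inj_on_def split_def\<close>)
qed

lemma hs_le_vcon:
  assumes "hs_le X a" "hs_le Y b" shows "hs_le (vcon X Y) (a * b)"
proof -
  have x: "l2_le (\<lambda>((i, j, k), m). X i j k m) a"
    by (rule l2_le_pullback[OF assms(1)[unfolded hs_le_def], of "\<lambda>((i, j, k), m). (i, j, k, m)"])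
       (auto simp: inj_on_def)
  have y: "l2_le (\<lambda>((i, k, l), m). Y i m k l) b"
    by (rule l2_le_pullback[OF assms(2)[unfolded hs_le_def], of "\<lambda>((i, k, l), m). (i, m, k, l)"])
       (auto simp: inj_on_def)
  show ?thesis unfolding hs_le_def vcon_def
    by (rule l2_le_pullback[OF l2_le_contract[of "\<lambda>(i, j, k) m. X i j k m" a "\<lambda>(i, k, l) m. Y i m k l" b],
            of "\<lambda>(i, j, k, l). ((fst i, j, fst k), (snd i, snd k, l))"])
       (use x y in \<open>auto simp: inj_on_def split_def\<close>)
qed

lemma hcon_add_left: "hs_le X a \<Longrightarrow> hs_le X' a' \<Longrightarrow> hs_le Y b \<Longrightarrow> hcon (X + X') Y = hcon X Y + hcon X' Y"
  unfolding hcon_def by (simp add: fun_eq_iff distrib_right infsum_add hcon_summable)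

lemma hcon_add_right: "hs_le X a \<Longrightarrow> hs_le Y b \<Longrightarrow> hs_le Y' b' \<Longrightarrow> hcon X (Y + Y') = hcon X Y + hcon X Y'"
  unfolding hcon_def by (simp add: fun_eq_iff distrib_left infsum_add hcon_summable)

lemma vcon_add_left: "hs_le X a \<Longrightarrow> hs_le X' a' \<Longrightarrow> hs_le Y b \<Longrightarrow> vcon (X + X') Y = vcon X Y + vcon X' Y"
  unfolding vcon_def by (simp add: fun_eq_iff distrib_right infsum_add vcon_summable)

lemma vcon_add_right: "hs_le X a \<Longrightarrow> hs_le Y b \<Longrightarrow> hs_le Y' b' \<Longrightarrow> vcon X (Y + Y') = vcon X Y + vcon X Y'"
  unfolding vcon_def by (simp add: fun_eq_iff distrib_left infsum_add vcon_summable)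

lemma vcon_scale_left: "vcon (scale4 s X) Y = scale4 s (vcon X Y)"
  unfolding vcon_def scale4_def by (simp add: infsum_cmult_right' mult.assoc)

lemma hcon_unit_left:
  "hcon unit4 Y i j k l = (if fst j = 0 \<and> k = 0 \<and> fst l = 0 then Y i (snd j) 0 (snd l) else 0)"
  unfolding hcon_def by (subst infsum_single[where z = 0]) (auto simp: unit4_def)

lemma hcon_unit_right:
  "hcon X unit4 i j k l = (if i = 0 \<and> snd j = 0 \<and> snd l = 0 then X 0 (fst j) k (fst l) else 0)"
  unfolding hcon_def by (subst infsum_single[where z = 0]) (auto simp: unit4_def)

lemma vcon_unit_left:
  "vcon unit4 Y i j k l = (if fst i = 0 \<and> j = 0 \<and> fst k = 0 then Y (snd i) 0 (snd k) l else 0)"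
  unfolding vcon_def by (subst infsum_single[where z = 0]) (auto simp: unit4_def)

lemma vcon_unit_right:
  "vcon X unit4 i j k l = (if snd i = 0 \<and> snd k = 0 \<and> l = 0 then X (fst i) j (fst k) 0 else 0)"
  unfolding vcon_def by (subst infsum_single[where z = 0]) (auto simp: unit4_def)

lemma prod_eq_0_iff: "p = 0 \<longleftrightarrow> fst p = 0 \<and> snd p = 0"
  by (cases p) (simp add: zero_prod_def)

lemma hcon_unit_unit: "hcon unit4 unit4 = unit4"
  by (auto simp: fun_eq_iff hcon_unit_left unit4_def prod_eq_0_iff)

lemma vcon_unit_unit: "vcon unit4 unit4 = unit4"
  by (auto simp: fun_eq_iff vcon_unit_left unit4_def prod_eq_0_iff)

text \<open>Both sides sum the same four-site block over its four internal bonds, one by columns and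
  one by rows; \<open>square_infsum\<close> compares each with the unordered sum.\<close>

lemma interchange:
  assumes "hs_le X a" "hs_le Y b" "hs_le X' a'" "hs_le Y' b'"
  shows "hcon (vcon X Y) (vcon X' Y') = vcon (hcon X X') (hcon Y Y')"
proof (intro ext)
  fix i j k l
  show "hcon (vcon X Y) (vcon X' Y') i j k l = vcon (hcon X X') (hcon Y Y') i j k l"
    using square_infsum[OF hs_le_slices(7)[OF assms(1), of "fst j" "fst k"]
        hs_le_slices(9)[OF assms(3), of "fst i" "snd j"]
        hs_le_slices(5)[OF assms(2), of "snd k" "fst l"]
        hs_le_slices(8)[OF assms(4), of "snd i" "snd l"]]
    by (simp add: hcon_def vcon_def split_def)
qed

text \<open>The bonds \<open>a\<close>, \<open>b\<close> are the horizontal ones and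
  \<open>c\<close>, \<open>d\<close> the vertical ones. Summing \<open>a\<close> and
  \<open>b\<close> first turns the block into two identical rows stacked on each other.\<close>

lemma block_eq:
  assumes "hs_le A a"
  shows "block A = vcon (hcon A A) (hcon A A)"
proof (intro ext)
  fix i j k l :: "nat \<times> nat"
  let ?f = "\<lambda>((a, b), (c, d)). A a (fst j) (fst k) c * A (fst i) (snd j) a d *
      A b c (snd k) (fst l) * A (snd i) d b (snd l)"
  have "block A i j k l = (\<Sum>\<^sub>\<infinity>(a, b, c, d). ?f ((a, b), (c, d)))"
    by (simp add: block_def split_def)
  also have "\<dots> = (\<Sum>\<^sub>\<infinity>z. ?f z)"
    using infsum_reindex_bij_betw[of "\<lambda>(a, b, c, d). ((a, b), (c, d))" UNIV UNIV ?f]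
    by (simp add: bij_betw_def inj_on_def split_def surj_def)
  also have "\<dots> = vcon (hcon A A) (hcon A A) i j k l"
    using square_infsum(1)[OF hs_le_slices(7)[OF assms, of "fst j" "fst k"]
        hs_le_slices(9)[OF assms, of "fst i" "snd j"]
        hs_le_slices(5)[OF assms, of "snd k" "fst l"]
        hs_le_slices(8)[OF assms, of "snd i" "snd l"]]
    by (simp add: hcon_def vcon_def split_def)
  finally show "block A i j k l = vcon (hcon A A) (hcon A A) i j k l" .
qed

lemma Umat_eq: "Umat Su Sd = vcon Sd Su"
  by (simp add: fun_eq_iff Umat_def vcon_def split_def)

lemma factor_cond_iff: "factor_cond S Su Sd \<longleftrightarrow> S = vcon Su Sd"
  by (auto simp: factor_cond_def vcon_def fun_eq_iff)

lemma hs_le_iff: "hs_le X c \<longleftrightarrow> hs4 X \<and> hsnorm4 X \<le> c"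
  by (simp add: hs_le_def l2_le_iff is_l2_def l2norm_def hs4_def hsnorm4_def split_def)

text \<open>A tensor on pairs of horizontal legs is read as an operator between the upper row
  \<open>(i, j, k)\<close> and the lower row \<open>(i', k', l)\<close>. Exhibiting a factorization into Hilbert--Schmidt
  factors of equal norm replaces the singular value decomposition.\<close>
definition nuclear :: "('a \<times> 'e, 'b, 'c \<times> 'f, 'g) tensor \<Rightarrow> real \<Rightarrow> bool" where
  "nuclear S c \<longleftrightarrow> 0 \<le> c \<and> (\<exists>(X :: ('a, 'b, 'c, nat) tensor) (Y :: ('e, nat, 'f, 'g) tensor).
     hs_le X (sqrt c) \<and> hs_le Y (sqrt c) \<and> S = vcon X Y)"

text \<open>Any countable bond embeds in the natural numbers by \<open>to_nat\<close>, with zeros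
  off its range. Product bonds arise from \<open>hcon\<close> and disjoint sums from addition, so a
  fixed bond type has to accommodate both.\<close>

lemma nuclearI:
  fixes X :: "('a, 'b, 'c, 'm::countable) tensor"
  assumes "0 \<le> c" "hs_le X (sqrt c)" "hs_le Y (sqrt c)"
  shows "nuclear (vcon X Y) c"
proof -
  define X' where "X' = (\<lambda>i j k n. if n \<in> range (to_nat :: 'm \<Rightarrow> nat) then X i j k (from_nat n) else 0)"
  define Y' where "Y' = (\<lambda>i n k l. if n \<in> range (to_nat :: 'm \<Rightarrow> nat) then Y i (from_nat n) k l else 0)"
  have x: "hs_le X' (sqrt c)"
    by (rule hs_le_pullback[OF assms(2), of "\<lambda>(i, j, k, n). (i, j, k, from_nat n)"])
       (auto simp: X'_def inj_on_def split: if_splits)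
  have y: "hs_le Y' (sqrt c)"
    by (rule hs_le_pullback[OF assms(3), of "\<lambda>(i, n, k, l). (i, from_nat n, k, l)"])
       (auto simp: Y'_def inj_on_def split: if_splits)
  have "vcon X Y = vcon X' Y'"
  proof (intro ext)
    fix i j k l
    have "vcon X' Y' i j k l = (\<Sum>\<^sub>\<infinity>n\<in>range (to_nat :: 'm \<Rightarrow> nat). X' (fst i) j (fst k) n * Y' (snd i) n (snd k) l)"
      unfolding vcon_def by (rule infsum_cong_neutral) (auto simp: X'_def)
    also have "\<dots> = vcon X Y i j k l"
      by (subst infsum_reindex) (auto simp: X'_def Y'_def vcon_def o_def)
    finally show "vcon X Y i j k l = vcon X' Y' i j k l" by simp
  qed
  then show ?thesis unfolding nuclear_def using x y assms(1) by blast
qed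

lemma nuclear_zero: "0 \<le> c \<Longrightarrow> nuclear 0 c"
  using nuclearI[of c "0 :: (_, _, _, nat) tensor" 0, OF _ hs_le_zero hs_le_zero] by (simp add: vcon_def zero_fun_def)

lemma hs_le_zero_eq: "hs_le X 0 \<Longrightarrow> X = 0"
  using hs_le_entry[of X 0] by (simp add: fun_eq_iff)

text \<open>Reciprocal scalars move between the factors until both norms are
  \<open>sqrt (a * b)\<close>. This balancing is impossible when a norm bound is 0, but then the
  contraction vanishes.\<close>

lemma nuclear_vcon:
  fixes X :: "('a, 'b, 'c, 'm::countable) tensor"
  assumes X: "hs_le X a" and Y: "hs_le Y b"
  shows "nuclear (vcon X Y) (a * b)"
proof (cases "a = 0 \<or> b = 0")
  case True
  then have "vcon X Y = 0"
    using hs_le_zero_eq[of X] hs_le_zero_eq[of Y] X Y by (auto simp: fun_eq_iff vcon_def)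
  then show ?thesis using nuclear_zero[of "a * b"] hs_le_nonneg[OF X] hs_le_nonneg[OF Y] by simp
next
  case False
  then have ab: "0 < a" "0 < b" using hs_le_nonneg[OF X] hs_le_nonneg[OF Y] by auto
  have "\<bar>sqrt (b / a)\<bar> * a = sqrt (a * b)" "\<bar>sqrt (a / b)\<bar> * b = sqrt (a * b)"
    using ab by (auto simp: real_sqrt_divide real_sqrt_mult field_simps)
  then have x: "hs_le (scale4 (sqrt (b / a)) X) (sqrt (a * b))" and y: "hs_le (scale4 (sqrt (a / b)) Y) (sqrt (a * b))"
    using hs_le_scale[OF X, of "sqrt (b / a)"] hs_le_scale[OF Y, of "sqrt (a / b)"] by auto
  have "sqrt (b / a) * sqrt (a / b) = 1" using ab by (simp add: real_sqrt_divide)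
  then have *: "(sqrt (b / a) * x) * (sqrt (a / b) * y) = x * y" for x y
    by (metis mult.left_neutral mult.assoc mult.left_commute)
  have "vcon (scale4 (sqrt (b / a)) X) (scale4 (sqrt (a / b)) Y) = vcon X Y"
    unfolding vcon_def scale4_def * ..
  then show ?thesis using nuclearI[OF _ x y] ab by simp
qed

lemma nuclear_mono:
  assumes "nuclear S c" "c \<le> d" shows "nuclear S d"
proof -
  obtain X Y where "hs_le X (sqrt c)" "hs_le Y (sqrt c)" "S = vcon X (Y :: (_, nat, _, _) tensor)" "0 \<le> c"
    using assms(1) by (auto simp: nuclear_def)
  then show ?thesis using nuclearI[of d X Y] hs_le_mono assms(2) real_sqrt_le_mono by (metis order_trans)
qed

lemma nuclear_scale:
  assumes "nuclear S c" shows "nuclear (scale4 s S) (\<bar>s\<bar> * c)"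
proof -
  obtain X Y where XY: "hs_le X (sqrt c)" "hs_le Y (sqrt c)" "S = vcon X (Y :: (_, nat, _, _) tensor)" "0 \<le> c"
    using assms(1) by (auto simp: nuclear_def)
  have "nuclear (vcon (scale4 s X) Y) (\<bar>s\<bar> * sqrt c * sqrt c)"
    by (rule nuclear_vcon[OF hs_le_scale]) (use XY in auto)
  then show ?thesis using XY by (simp add: vcon_scale_left mult.assoc)
qed

lemma nuclear_uminus: "nuclear S c \<Longrightarrow> nuclear (- S) c"
  using nuclear_scale[of S c "-1"] by (simp add: scale4_def fun_Compl_def)

text \<open>The triangle inequality by direct sums: the two bonds are put side by side, so the
  contractions add and the squared norms of the factors add as well.\<close>

lemma nuclear_add:
  assumes "nuclear S c" "nuclear S' d" shows "nuclear (S + S') (c + d)"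
proof -
  obtain X Y where XY: "hs_le X (sqrt c)" "hs_le Y (sqrt c)" "S = vcon X (Y :: (_, nat, _, _) tensor)" "0 \<le> c"
    using assms(1) by (auto simp: nuclear_def)
  obtain X' Y' where XY': "hs_le X' (sqrt d)" "hs_le Y' (sqrt d)" "S' = vcon X' (Y' :: (_, nat, _, _) tensor)" "0 \<le> d"
    using assms(2) by (auto simp: nuclear_def)
  have sq: "l2_le (case_sum f g) (sqrt (c + d))" if "l2_le f (sqrt c)" "l2_le g (sqrt d)" for f :: "'u \<Rightarrow> real" and g :: "'v \<Rightarrow> real"
  proof (rule l2_leI_sq)
    fix F :: "('u + 'v) set" assume F: "finite F"
    have "F = Inl ` (Inl -` F) \<union> Inr ` (Inr -` F)"
    proof (intro set_eqI)
      fix x show "x \<in> F \<longleftrightarrow> x \<in> Inl ` (Inl -` F) \<union> Inr ` (Inr -` F)" by (cases x) auto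
    qed
    then have "(\<Sum>x\<in>F. (case_sum f g x)\<^sup>2) = (\<Sum>x\<in>Inl ` (Inl -` F) \<union> Inr ` (Inr -` F). (case_sum f g x)\<^sup>2)"
      by simp
    also have "\<dots> = (\<Sum>x\<in>Inl -` F. (f x)\<^sup>2) + (\<Sum>x\<in>Inr -` F. (g x)\<^sup>2)"
      using F by (subst sum.union_disjoint) (auto simp: sum.reindex finite_vimageI simp del: image_vimage_eq)
    also have "\<dots> \<le> (sqrt c)\<^sup>2 + (sqrt d)\<^sup>2"
      using F by (intro add_mono l2_leD_sq that finite_vimageI) auto
    finally show "(\<Sum>x\<in>F. (case_sum f g x)\<^sup>2) \<le> (sqrt (c + d))\<^sup>2" using XY(4) XY'(4) by simp
  qed (use XY(4) XY'(4) in simp)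
  define U where "U = (\<lambda>i j k. case_sum (X i j k) (X' i j k))"
  define V where "V = (\<lambda>i m k l. case m of Inl m \<Rightarrow> Y i m k l | Inr m \<Rightarrow> Y' i m k l)"
  have u: "hs_le U (sqrt (c + d))"
    unfolding hs_le_def
    by (rule l2_le_pullback[OF sq[OF XY(1)[unfolded hs_le_def] XY'(1)[unfolded hs_le_def]],
         of "\<lambda>(i, j, k, m). case m of Inl m \<Rightarrow> Inl (i, j, k, m) | Inr m \<Rightarrow> Inr (i, j, k, m)"])
       (auto simp: U_def inj_on_def split: sum.splits)
  have v: "hs_le V (sqrt (c + d))"
    unfolding hs_le_def
    by (rule l2_le_pullback[OF sq[OF XY(2)[unfolded hs_le_def] XY'(2)[unfolded hs_le_def]],
         of "\<lambda>(i, m, k, l). case m of Inl m \<Rightarrow> Inl (i, m, k, l) | Inr m \<Rightarrow> Inr (i, m, k, l)"])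
       (auto simp: V_def inj_on_def split: sum.splits)
  have "vcon U V = S + S'"
  proof (intro ext)
    fix i j k l
    let ?f = "\<lambda>m. U (fst i) j (fst k) m * V (snd i) m (snd k) l"
    have s: "?f summable_on UNIV" by (rule vcon_summable[OF u v])
    have "vcon U V i j k l = infsum ?f (range Inl \<union> range Inr)"
      by (simp add: vcon_def UNIV_sum)
    also have "\<dots> = infsum ?f (range Inl) + infsum ?f (range Inr)"
      by (rule infsum_Un_disjoint) (auto intro: summable_on_subset_banach[OF s])
    also have "\<dots> = (S + S') i j k l"
      by (simp add: infsum_reindex o_def U_def V_def XY(3) XY'(3) vcon_def)
    finally show "vcon U V i j k l = (S + S') i j k l" .
  qed
  then show ?thesis using nuclearI[OF _ u v] XY(4) XY'(4) by simp
qed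

lemma nuclear_diff: "nuclear S a \<Longrightarrow> nuclear S' b \<Longrightarrow> nuclear (S - S') (a + b)"
  using nuclear_add[OF _ nuclear_uminus, of S a S' b] by simp

lemma nuclear_hs_le: assumes "nuclear S c" shows "hs_le S c"
proof -
  obtain X Y where XY: "hs_le X (sqrt c)" "hs_le Y (sqrt c)" "S = vcon X (Y :: (_, nat, _, _) tensor)" "0 \<le> c"
    using assms(1) by (auto simp: nuclear_def)
  then show ?thesis using hs_le_vcon[OF XY(1,2)] by simp
qed

lemma nuclear_unit: "nuclear unit4 1"
  using nuclear_vcon[OF hs_le_unit hs_le_unit[where ?'b = nat]] by (simp add: vcon_unit_unit)

lemma nuclear_hcon:
  assumes "nuclear S c" "nuclear S' d" shows "nuclear (hcon S S') (c * d)"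
proof -
  obtain X Y where XY: "hs_le X (sqrt c)" "hs_le Y (sqrt c)" "S = vcon X (Y :: (_, nat, _, _) tensor)" "0 \<le> c"
    using assms(1) by (auto simp: nuclear_def)
  obtain X' Y' where XY': "hs_le X' (sqrt d)" "hs_le Y' (sqrt d)" "S' = vcon X' (Y' :: (_, nat, _, _) tensor)" "0 \<le> d"
    using assms(2) by (auto simp: nuclear_def)
  have "hcon S S' = vcon (hcon X X') (hcon Y Y')"
    unfolding XY(3) XY'(3) by (rule interchange[OF XY(1,2) XY'(1,2)])
  then show ?thesis
    using nuclear_vcon[OF hs_le_hcon[OF XY(1) XY'(1)] hs_le_hcon[OF XY(2) XY'(2)]] XY(4) XY'(4)
    by (simp add: mult_ac real_sqrt_mult[symmetric] flip: real_sqrt_mult)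
qed

text \<open>A reindexing preserves a factorization only if it treats the legs of the upper row and
  those of the lower row separately; hence one map \<open>p\<close> and one map \<open>q\<close>
  with their own supports.\<close>

lemma nuclear_pullback:
  assumes "nuclear S c"
    and p: "inj_on p {(i, j, k). P i j k}" and q: "inj_on q {(i, k, l). Q i k l}"
    and S': "\<And>i i' j k k' l. S' (i, i') j (k, k') l = (if P i j k \<and> Q i' k' l then
       (case p (i, j, k) of (a, b, c) \<Rightarrow> case q (i', k', l) of (a', c', d) \<Rightarrow> S (a, a') b (c, c') d) else 0)"
  shows "nuclear S' c"
proof -
  obtain X Y where XY: "hs_le X (sqrt c)" "hs_le Y (sqrt c)" "S = vcon X (Y :: (_, nat, _, _) tensor)" "0 \<le> c"
    using assms(1) by (auto simp: nuclear_def)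
  define U where "U = (\<lambda>i j k m. if P i j k then (case p (i, j, k) of (a, b, c) \<Rightarrow> X a b c m) else 0)"
  define V where "V = (\<lambda>i m k l. if Q i k l then (case q (i, k, l) of (a, c, d) \<Rightarrow> Y a m c d) else 0)"
  have u: "hs_le U (sqrt c)"
    by (rule hs_le_pullback[OF XY(1), of "\<lambda>(i, j, k, m). case p (i, j, k) of (a, b, c) \<Rightarrow> (a, b, c, m)"])
       (use p in \<open>auto simp: U_def inj_on_def split: if_splits prod.splits\<close>)
  have v: "hs_le V (sqrt c)"
    by (rule hs_le_pullback[OF XY(2), of "\<lambda>(i, m, k, l). case q (i, k, l) of (a, c, d) \<Rightarrow> (a, m, c, d)"])
       (use q in \<open>auto simp: V_def inj_on_def split: if_splits prod.splits\<close>)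
  have "S' = vcon U V"
    by (auto simp: fun_eq_iff S' U_def V_def vcon_def XY(3) split: prod.splits)
  then show ?thesis using nuclearI[OF XY(4) u v] by simp
qed

section \<open>Finite-rank perturbations of the identity\<close>

text \<open>The dummy vertical legs make the action of a matrix on the horizontal legs an instance of
  \<open>hcon\<close>.\<close>
definition mat_tensor :: "('a \<Rightarrow> 'a \<Rightarrow> real) \<Rightarrow> ('a, nat, 'a, nat) tensor" where
  "mat_tensor g = (\<lambda>x j y l. if j = 0 \<and> l = 0 then g y x else 0)"

definition Lact :: "('a \<Rightarrow> 'a \<Rightarrow> real) \<Rightarrow> ('a, 'b, 'c, 'd) tensor \<Rightarrow> ('a, 'b, 'c, 'd) tensor" where
  "Lact g X = (\<lambda>i j k l. hcon X (mat_tensor g) i (j, 0) k (l, 0))"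

definition Ract :: "('c \<Rightarrow> 'c \<Rightarrow> real) \<Rightarrow> ('a, 'b, 'c, 'd) tensor \<Rightarrow> ('a, 'b, 'c, 'd) tensor" where
  "Ract g X = (\<lambda>i j k l. hcon (mat_tensor g) X i (0, j) k (0, l))"

lemma Lact_eq: "Lact g X i j k l = (\<Sum>\<^sub>\<infinity>a. X a j k l * g a i)"
  by (simp add: Lact_def hcon_def mat_tensor_def)

lemma Ract_eq: "Ract g X i j k l = (\<Sum>\<^sub>\<infinity>a. g k a * X i j a l)"
  by (simp add: Ract_def hcon_def mat_tensor_def)

lemma hs_le_Lact: "hs_le X a \<Longrightarrow> hs_le (mat_tensor g) c \<Longrightarrow> hs_le (Lact g X) (a * c)"
  by (drule (1) hs_le_hcon, erule hs_le_pullback[of _ _ "\<lambda>(i, j, k, l). (i, (j, 0), k, (l, 0))"])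
     (auto simp: inj_on_def Lact_def)

lemma hs_le_Ract: "hs_le X a \<Longrightarrow> hs_le (mat_tensor g) c \<Longrightarrow> hs_le (Ract g X) (c * a)"
  by (drule (1) hs_le_hcon[rotated], erule hs_le_pullback[of _ _ "\<lambda>(i, j, k, l). (i, (0, j), k, (0, l))"])
     (auto simp: inj_on_def Ract_def)

lemma nuclear_Lact: "nuclear X a \<Longrightarrow> nuclear (mat_tensor g) c \<Longrightarrow> nuclear (Lact g X) (a * c)"
  by (drule (1) nuclear_hcon, erule nuclear_pullback[where P = "\<lambda>_ _ _. True" and Q = "\<lambda>_ _ _. True" and
        p = "\<lambda>(i, j, k). (i, (j, 0), k)" and q = "\<lambda>(i, k, l). (i, k, (l, 0))"])
     (auto simp: inj_on_def Lact_def)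

lemma nuclear_Ract: "nuclear X a \<Longrightarrow> nuclear (mat_tensor g) c \<Longrightarrow> nuclear (Ract g X) (c * a)"
  by (drule (1) nuclear_hcon[rotated], erule nuclear_pullback[where P = "\<lambda>_ _ _. True" and Q = "\<lambda>_ _ _. True" and
        p = "\<lambda>(i, j, k). (i, (0, j), k)" and q = "\<lambda>(i, k, l). (i, k, (0, l))"])
     (auto simp: inj_on_def Ract_def)

lemma Lact_add: "hs_le X a \<Longrightarrow> hs_le Y b \<Longrightarrow> hs_le (mat_tensor g) c \<Longrightarrow> Lact g (X + Y) = Lact g X + Lact g Y"
  by (simp add: Lact_def hcon_add_left fun_eq_iff)

lemma Ract_add: "hs_le X a \<Longrightarrow> hs_le Y b \<Longrightarrow> hs_le (mat_tensor g) c \<Longrightarrow> Ract g (X + Y) = Ract g X + Ract g Y"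
  by (simp add: Ract_def hcon_add_right fun_eq_iff)

lemma Lact_unit: "Lact g unit4 = (\<lambda>i j k l. if j = 0 \<and> k = 0 \<and> l = 0 then g 0 i else 0)"
  by (auto simp: Lact_def hcon_unit_left mat_tensor_def fun_eq_iff)

lemma Ract_unit: "Ract g unit4 = (\<lambda>i j k l. if i = 0 \<and> j = 0 \<and> l = 0 then g k 0 else 0)"
  by (auto simp: Ract_def hcon_unit_right mat_tensor_def fun_eq_iff)

text \<open>The identity of an infinite-dimensional space is not Hilbert-Schmidt, so only the
  deviation \<open>g\<close> is estimated by tensor norms.\<close>

definition id_plus :: "('a \<Rightarrow> 'a \<Rightarrow> real) \<Rightarrow> 'a \<Rightarrow> 'a \<Rightarrow> real" where
  "id_plus g i j = of_bool (i = j) + g i j"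

lemma l2_le_delta: "l2_le (\<lambda>x. of_bool (x = z)) 1" "l2_le (\<lambda>x. of_bool (z = x)) 1"
proof -
  have "l2_le (\<lambda>x::unit. 1) 1"
    by (auto intro!: l2_leI_sq simp: card_le_Suc0_iff_eq)
  then show "l2_le (\<lambda>x. of_bool (x = z)) 1" "l2_le (\<lambda>x. of_bool (z = x)) 1"
    by (auto elim!: l2_le_pullback[where h = "\<lambda>_. ()"] simp: inj_on_def)
qed

lemma infsum_id_plus_left:
  assumes "l2_le x a" "l2_le (g i) c"
  shows "(\<Sum>\<^sub>\<infinity>j. id_plus g i j * x j) = x i + (\<Sum>\<^sub>\<infinity>j. g i j * x j)"
proof -
  have "(\<Sum>\<^sub>\<infinity>j. id_plus g i j * x j) = (\<Sum>\<^sub>\<infinity>j. of_bool (i = j) * x j) + (\<Sum>\<^sub>\<infinity>j. g i j * x j)"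
    unfolding id_plus_def distrib_right
    by (rule infsum_add[OF l2_le_mult_summable[OF l2_le_delta(2) assms(1)] l2_le_mult_summable[OF assms(2,1)]])
  also have "(\<Sum>\<^sub>\<infinity>j. of_bool (i = j) * x j) = x i"
    by (subst infsum_single[where z = i]) auto
  finally show ?thesis .
qed

lemma infsum_id_plus_right:
  assumes "l2_le x a" "l2_le (\<lambda>j. g j i) c"
  shows "(\<Sum>\<^sub>\<infinity>j. id_plus g j i * x j) = x i + (\<Sum>\<^sub>\<infinity>j. x j * g j i)"
  using infsum_id_plus_left[of x a "\<lambda>i j. g j i" i c] assms
  by (simp add: id_plus_def mult.commute eq_commute)

lemma hs_le_mat_tensor_slices:
  assumes "hs_le (mat_tensor g) c"
  shows "l2_le (\<lambda>(i, j). g i j) c" "l2_le (g i) c" "l2_le (\<lambda>i. g i j) c"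
proof -
  show *: "l2_le (\<lambda>(i, j). g i j) c"
    by (rule hs_le_slice[OF assms, of "\<lambda>(i, j). (j, 0, i, 0)"]) (auto simp: inj_def mat_tensor_def)
  show "l2_le (g i) c" by (rule l2_le_slice[OF *])
  show "l2_le (\<lambda>i. g i j) c"
    by (rule l2_le_pullback[OF *, where h = "\<lambda>i. (i, j)"]) (auto simp: inj_on_def)
qed

text \<open>This double sum is common to the horizontal gauge transform and to \<open>conjR\<close>.
  The four terms are kept apart because they have different orders in \<open>t\<close>.\<close>

lemma conj_expand:
  assumes X: "hs_le X a" and g: "hs_le (mat_tensor g) c" and h: "hs_le (mat_tensor h) d"
  shows "(\<Sum>\<^sub>\<infinity>(i', k'). id_plus g i' i * X i' j k' l * id_plus h k k')
    = (X + Ract h X + (Lact g X + Lact g (Ract h X))) i j k l"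
proof -
  have u: "l2_le (\<lambda>i'. id_plus g i' i) (1 + c)"
    unfolding id_plus_def by (rule l2_le_add[OF l2_le_delta(1) hs_le_mat_tensor_slices(3)[OF g]])
  have v: "l2_le (\<lambda>k'. id_plus h k k') (1 + d)"
    unfolding id_plus_def by (rule l2_le_add[OF l2_le_delta(2) hs_le_mat_tensor_slices(2)[OF h]])
  have s: "(\<lambda>(i', k'). id_plus g i' i * X i' j k' l * id_plus h k k') summable_on UNIV"
    using l2_le_mult_summable[OF l2_le_tensor[OF u v] hs_le_slices(6)[OF X, of j l]]
    by (simp add: split_def mult_ac)
  have R: "hs_le (X + Ract h X) (a + d * a)" by (rule hs_le_add[OF X hs_le_Ract[OF X h]])
  have "(\<Sum>\<^sub>\<infinity>(i', k'). id_plus g i' i * X i' j k' l * id_plus h k k')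
      = (\<Sum>\<^sub>\<infinity>i'. id_plus g i' i * (\<Sum>\<^sub>\<infinity>k'. id_plus h k k' * X i' j k' l))"
    by (subst infsum_prod_eq[OF s]) (simp add: infsum_cmult_right'[symmetric] mult_ac)
  also have "\<dots> = (\<Sum>\<^sub>\<infinity>i'. id_plus g i' i * (X + Ract h X) i' j k l)"
    by (simp add: infsum_id_plus_left[OF hs_le_slices(3)[OF X] hs_le_mat_tensor_slices(2)[OF h]] Ract_eq)
  also have "\<dots> = (X + Ract h X) i j k l + Lact g (X + Ract h X) i j k l"
    by (simp only: infsum_id_plus_right[OF hs_le_slices(1)[OF R] hs_le_mat_tensor_slices(3)[OF g]] Lact_eq)
  finally show ?thesis using Lact_add[OF X hs_le_Ract[OF X h] g] by simp
qed

lemma bounded_mat_id_plus: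
  assumes g: "l2_le (\<lambda>(i, j). g i j) c"
  shows "bounded_mat (id_plus g)"
    and "\<And>x. is_l2 x \<Longrightarrow> mat_apply (id_plus g) x = (\<lambda>i. x i + (\<Sum>\<^sub>\<infinity>j. g i j * x j))"
    and "\<And>x. is_l2 x \<Longrightarrow> is_l2 (mat_apply (id_plus g) x)"
proof -
  show eq: "mat_apply (id_plus g) x = (\<lambda>i. x i + (\<Sum>\<^sub>\<infinity>j. g i j * x j))" if "is_l2 x" for x
    unfolding mat_apply_def
    by (intro ext infsum_id_plus_left[OF l2_le_slice_norm[OF that] l2_le_slice[OF g]])
  have bd: "l2_le (mat_apply (id_plus g) x) ((1 + c) * l2norm x)" if x: "is_l2 x" for x
  proof -
    have "l2_le (\<lambda>(_::unit, j). x j) (l2norm x)"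
      by (rule l2_le_pullback[OF l2_le_slice_norm[OF x], where h = snd]) (auto simp: inj_on_def)
    from l2_le_contract[OF g this]
    have "l2_le (\<lambda>i. \<Sum>\<^sub>\<infinity>j. g i j * x j) (c * l2norm x)"
      by (rule l2_le_pullback[where h = "\<lambda>i. (i, ())"]) (auto simp: inj_on_def)
    from l2_le_add[OF l2_le_slice_norm[OF x] this] show ?thesis
      unfolding eq[OF x] by (simp add: distrib_right)
  qed
  show "is_l2 (mat_apply (id_plus g) x)" if "is_l2 x" for x
    using bd[OF that] by (simp add: l2_le_iff)
  show "bounded_mat (id_plus g)"
    unfolding bounded_mat_def
  proof (intro exI[of _ "1 + c"] allI impI conjI)
    fix x :: "'a \<Rightarrow> real" and i assume x: "is_l2 x"
    show "(\<lambda>j. id_plus g i j * x j) summable_on UNIV"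
      unfolding id_plus_def
      by (rule l2_le_mult_summable[OF l2_le_add[OF l2_le_delta(2) l2_le_slice[OF g]] l2_le_slice_norm[OF x]])
    show "is_l2 (mat_apply (id_plus g) x)" "l2norm (mat_apply (id_plus g) x) \<le> (1 + c) * l2norm x"
      using bd[OF x] by (simp_all add: l2_le_iff)
  qed
qed

text \<open>With \<open>e\<close> the basis vector at \<open>0\<close>, \<open>id_plus (shear N M)\<close> is \<open>(1 - e N\<^sup>T) (1 + M e\<^sup>T)\<close>; the inverse is explicit
  because \<open>N\<close> and \<open>M\<close> vanish at \<open>0\<close>. It prescribes row \<open>0\<close> of the operator and column \<open>0\<close> of
  its inverse independently.\<close>
definition shear :: "('a::zero \<Rightarrow> real) \<Rightarrow> ('a \<Rightarrow> real) \<Rightarrow> 'a \<Rightarrow> 'a \<Rightarrow> real" where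
  "shear N M i j = (if i = 0 then - N j else 0) + (if j = 0 then M i else 0)
     - (if i = 0 \<and> j = 0 then (\<Sum>\<^sub>\<infinity>x. N x * M x) else 0)"

definition shear_inv :: "('a::zero \<Rightarrow> real) \<Rightarrow> ('a \<Rightarrow> real) \<Rightarrow> 'a \<Rightarrow> 'a \<Rightarrow> real" where
  "shear_inv N M i j = (if j = 0 then - M i else 0) + (if i = 0 then N j else 0) - M i * N j"

definition rowt :: "('a \<Rightarrow> real) \<Rightarrow> ('a, 'b::zero, 'c::zero, 'd::zero) tensor" where
  "rowt N = (\<lambda>i j k l. if j = 0 \<and> k = 0 \<and> l = 0 then N i else 0)"

definition colt :: "('c \<Rightarrow> real) \<Rightarrow> ('a::zero, 'b::zero, 'c, 'd::zero) tensor" where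
  "colt M = (\<lambda>i j k l. if i = 0 \<and> j = 0 \<and> l = 0 then M k else 0)"

lemma hs_le_rowt: "l2_le N a \<Longrightarrow> hs_le (rowt N) a"
  unfolding hs_le_def rowt_def
  by (erule l2_le_pullback[where h = "\<lambda>(i, j, k, l). i"]) (auto simp: inj_on_def split: if_splits)

lemma hs_le_colt: "l2_le M a \<Longrightarrow> hs_le (colt M) a"
  unfolding hs_le_def colt_def
  by (erule l2_le_pullback[where h = "\<lambda>(i, j, k, l). k"]) (auto simp: inj_on_def split: if_splits)

lemma mat_tensor_shear: "mat_tensor (shear N M) = colt M - rowt N - scale4 (\<Sum>\<^sub>\<infinity>x. N x * M x) unit4"
  by (auto simp: mat_tensor_def shear_def rowt_def colt_def scale4_def unit4_def fun_eq_iff)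

text \<open>Writing the rank-one term \<open>M i * N j\<close> as an action of the row matrix on
  \<open>colt M\<close> makes both the Hilbert-Schmidt and the nuclear bounds for
  \<open>Lact\<close> applicable to it.\<close>

lemma mat_tensor_shear_inv:
  "mat_tensor (shear_inv N M) = rowt N - colt M - Lact (\<lambda>i j. if i = 0 then N j else 0) (colt M)"
proof -
  have "Lact (\<lambda>i j. if i = 0 then N j else 0) (colt M) = (\<lambda>x j y l. if j = 0 \<and> l = 0 then M y * N x else 0)"
    by (auto simp: fun_eq_iff Lact_eq colt_def infsum_single[where z = 0])
  note * = this
  show ?thesis
    unfolding * by (auto simp: mat_tensor_def shear_inv_def rowt_def colt_def fun_eq_iff)
qed

lemma mat_tensor_row: "mat_tensor (\<lambda>i j. if i = 0 then N j else 0) = rowt N"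
  by (auto simp: mat_tensor_def rowt_def fun_eq_iff)

text \<open>Both operators are evaluated on vectors, \<open>Ge\<close> and \<open>He\<close>, and
  composed. They change a vector only along \<open>M\<close> and along the basis vector at 0, so the
  composition depends only on the component at 0 and the pairing with \<open>N\<close>.\<close>

lemma shear_id_plus_inv_pair:
  assumes N: "l2_le N a" "N 0 = 0" and M: "l2_le M b" "M 0 = 0"
  shows "bounded_inv_pair (id_plus (shear N M)) (id_plus (shear_inv N M))"
proof -
  define \<nu> where "\<nu> = (\<Sum>\<^sub>\<infinity>x. N x * M x)"
  have g: "hs_le (mat_tensor (shear N M)) (b + a + \<bar>\<nu>\<bar> * 1)"
    unfolding mat_tensor_shear \<nu>_def by (intro hs_le_diff hs_le_rowt hs_le_colt hs_le_scale hs_le_unit N M)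
  have h: "hs_le (mat_tensor (shear_inv N M)) (a + b + b * a)"
    unfolding mat_tensor_shear_inv by (intro hs_le_diff hs_le_rowt hs_le_colt hs_le_Lact N M) (simp add: mat_tensor_row hs_le_rowt N)
  note G = bounded_mat_id_plus[OF hs_le_mat_tensor_slices(1)[OF g]] and H = bounded_mat_id_plus[OF hs_le_mat_tensor_slices(1)[OF h]]
  have Ge: "mat_apply (id_plus (shear N M)) x =
     (\<lambda>i. x i + M i * x 0 - (if i = 0 then (\<Sum>\<^sub>\<infinity>j. N j * x j) + \<nu> * x 0 else 0))" if x: "is_l2 x" for x
  proof (rule ext)
    fix i
    have l: "l2_le x (l2norm x)" by (rule l2_le_slice_norm[OF x])
    have "(\<Sum>\<^sub>\<infinity>j. shear N M i j * x j) = (\<Sum>\<^sub>\<infinity>j. (if i = 0 then - 1 else 0) * (N j * x j) + of_bool (j = 0) * ((M i - (if i = 0 then \<nu> else 0)) * x j))"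
      by (rule infsum_cong) (auto simp: shear_def \<nu>_def algebra_simps)
    also have "\<dots> = (\<Sum>\<^sub>\<infinity>j. (if i = 0 then - 1 else 0) * (N j * x j)) + (\<Sum>\<^sub>\<infinity>j. of_bool (j = 0) * ((M i - (if i = 0 then \<nu> else 0)) * x j))"
      by (intro infsum_add summable_on_cmult_right l2_le_mult_summable[OF N(1) l]
           l2_le_mult_summable[OF l2_le_delta(1) l2_le_scale[OF l]])
    also have "\<dots> = (if i = 0 then - 1 else 0) * (\<Sum>\<^sub>\<infinity>j. N j * x j) + (M i - (if i = 0 then \<nu> else 0)) * x 0"
      by (simp add: infsum_cmult_right' infsum_single[where z = 0])
    finally show "mat_apply (id_plus (shear N M)) x i =
       x i + M i * x 0 - (if i = 0 then (\<Sum>\<^sub>\<infinity>j. N j * x j) + \<nu> * x 0 else 0)"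
      unfolding G(2)[OF x] by (cases "i = 0") (simp_all add: algebra_simps)
  qed
  have He: "mat_apply (id_plus (shear_inv N M)) x =
     (\<lambda>i. x i + (if i = 0 then (\<Sum>\<^sub>\<infinity>j. N j * x j) else 0) - M i * (x 0 + (\<Sum>\<^sub>\<infinity>j. N j * x j)))" if x: "is_l2 x" for x
  proof (rule ext)
    fix i
    have l: "l2_le x (l2norm x)" by (rule l2_le_slice_norm[OF x])
    have "(\<Sum>\<^sub>\<infinity>j. shear_inv N M i j * x j) = (\<Sum>\<^sub>\<infinity>j. ((if i = 0 then 1 else 0) - M i) * (N j * x j) + of_bool (j = 0) * (- M i * x j))"
      by (rule infsum_cong) (auto simp: shear_inv_def algebra_simps)
    also have "\<dots> = (\<Sum>\<^sub>\<infinity>j. ((if i = 0 then 1 else 0) - M i) * (N j * x j)) + (\<Sum>\<^sub>\<infinity>j. of_bool (j = 0) * (- M i * x j))"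
      by (intro infsum_add summable_on_cmult_right l2_le_mult_summable[OF N(1) l]
           l2_le_mult_summable[OF l2_le_delta(1) l2_le_scale[OF l]])
    also have "\<dots> = ((if i = 0 then 1 else 0) - M i) * (\<Sum>\<^sub>\<infinity>j. N j * x j) + (- M i * x 0)"
      by (simp add: infsum_cmult_right' infsum_single[where z = 0])
    finally show "mat_apply (id_plus (shear_inv N M)) x i =
       x i + (if i = 0 then (\<Sum>\<^sub>\<infinity>j. N j * x j) else 0) - M i * (x 0 + (\<Sum>\<^sub>\<infinity>j. N j * x j))"
      unfolding H(2)[OF x] by (cases "i = 0") (simp_all add: algebra_simps)
  qed
  \<comment> \<open>Since \<open>N\<close> vanishes at 0, pairing with \<open>N\<close> does not see
    the correction \<open>e\<close>, and a shift along \<open>M\<close> changes it by a multiple of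
    \<open>\<nu>\<close>.\<close>
  have ip: "(\<Sum>\<^sub>\<infinity>j. N j * (x j + e j - M j * s)) = (\<Sum>\<^sub>\<infinity>j. N j * x j) - \<nu> * s"
    if x: "is_l2 x" and e: "\<And>j. j \<noteq> 0 \<Longrightarrow> e j = 0" for x e s
  proof -
    have "(\<Sum>\<^sub>\<infinity>j. N j * (x j + e j - M j * s)) = (\<Sum>\<^sub>\<infinity>j. N j * x j + (- s) * (N j * M j))"
      by (rule infsum_cong) (use e N(2) in \<open>force simp: algebra_simps\<close>)
    also have "\<dots> = (\<Sum>\<^sub>\<infinity>j. N j * x j) + (\<Sum>\<^sub>\<infinity>j. (- s) * (N j * M j))"
      by (intro infsum_add summable_on_cmult_right l2_le_mult_summable[OF N(1) l2_le_slice_norm[OF x]]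
            l2_le_mult_summable[OF N(1) M(1)])
    also have "(\<Sum>\<^sub>\<infinity>j. (- s) * (N j * M j)) = (- s) * \<nu>"
      unfolding \<nu>_def by (rule infsum_cmult_right')
    finally show ?thesis by (simp add: mult.commute)
  qed
  show ?thesis
    unfolding bounded_inv_pair_def
  proof (intro conjI allI impI)
    fix x :: "'a \<Rightarrow> real" assume x: "is_l2 x"
    let ?n = "\<Sum>\<^sub>\<infinity>j. N j * x j"
    show "mat_apply (id_plus (shear N M)) (mat_apply (id_plus (shear_inv N M)) x) = x"
      unfolding Ge[OF H(3)[OF x]]
      unfolding He[OF x] ip[OF x, of "\<lambda>j. if j = 0 then ?n else 0" "x 0 + ?n", simplified]
      by (auto simp: fun_eq_iff M N algebra_simps)
    \<comment> \<open>Brings the image under the shear into the shape required by \<open>ip\<close>,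
      with \<open>s = - x 0\<close>.\<close>
    have y: "x i + M i * x 0 - (if i = 0 then ?n + \<nu> * x 0 else 0) =
        x i + (if i = 0 then - (?n + \<nu> * x 0) else 0) - M i * (- x 0)" for i by auto
    have n': "(\<Sum>\<^sub>\<infinity>j. N j * (x j + M j * x 0 - (if j = 0 then ?n + \<nu> * x 0 else 0))) = ?n + \<nu> * x 0"
      unfolding y by (subst ip[OF x]) auto
    show "mat_apply (id_plus (shear_inv N M)) (mat_apply (id_plus (shear N M)) x) = x"
      unfolding He[OF G(3)[OF x]]
      unfolding Ge[OF x] n'
      by (auto simp: fun_eq_iff M N algebra_simps)
  qed (rule G(1) H(1))+
qed

section \<open>Orthonormal families\<close>

definition orthonormal_family :: "('p \<Rightarrow> 'x \<Rightarrow> real) \<Rightarrow> bool" where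
  "orthonormal_family \<phi> \<longleftrightarrow> (\<forall>p. l2_le (\<phi> p) 1) \<and> (\<forall>p q. (\<Sum>\<^sub>\<infinity>x. \<phi> p x * \<phi> q x) = of_bool (p = q))"

text \<open>The projection \<open>s\<close> of \<open>t\<close> onto the finite span satisfies <s,s>
  = <s,t> = \<open>S\<close>, and Cauchy-Schwarz gives \<open>S \<le> sqrt S * c\<close>. The case
  \<open>S = 0\<close> is separate because \<open>sqrt S\<close> is cancelled.\<close>

lemma bessel_inequality:
  assumes on: "orthonormal_family \<phi>" and t: "l2_le t c" and P: "finite P"
  shows "(\<Sum>p\<in>P. (\<Sum>\<^sub>\<infinity>x. \<phi> p x * t x)\<^sup>2) \<le> c\<^sup>2"
proof -
  define a where "a p = (\<Sum>\<^sub>\<infinity>x. \<phi> p x * t x)" for p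
  define S where "S = (\<Sum>p\<in>P. (a p)\<^sup>2)"
  define s where "s x = (\<Sum>p\<in>P. a p * \<phi> p x)" for x
  have \<phi>: "l2_le (\<phi> p) 1" and ip: "(\<Sum>\<^sub>\<infinity>x. \<phi> p x * \<phi> q x) = of_bool (p = q)" for p q
    using on by (auto simp: orthonormal_family_def)
  have hs: "((\<lambda>x. s x * u x) has_sum (\<Sum>p\<in>P. a p * (\<Sum>\<^sub>\<infinity>x. \<phi> p x * u x))) UNIV" if "l2_le u d" for u d
    unfolding s_def sum_distrib_right mult.assoc
    by (intro has_sum_sum[OF P] has_sum_cmult_right has_sum_infsum l2_le_mult_summable[OF \<phi> that])
  have phis: "(\<Sum>\<^sub>\<infinity>x. \<phi> q x * s x) = (if q \<in> P then a q else 0)" for q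
  proof -
    have "(\<Sum>\<^sub>\<infinity>x. s x * \<phi> q x) = (\<Sum>p\<in>P. a p * of_bool (p = q))"
      using infsumI[OF hs[OF \<phi>[of q]]] by (simp add: ip)
    also have "\<dots> = (if q \<in> P then a q else 0)"
      using P by (subst sum.cong[OF refl, of _ _ "\<lambda>p. if p = q then a p else 0"]) auto
    finally show ?thesis by (simp add: mult.commute)
  qed
  have "\<exists>d. l2_le (\<lambda>x. \<Sum>p\<in>Q. a p * \<phi> p x) d" if "finite Q" for Q
    using that
  proof (induction Q)
    case empty
    then show ?case using l2_le_zero[of 0] by auto
  next
    case (insert q Q)
    then obtain d where "l2_le (\<lambda>x. \<Sum>p\<in>Q. a p * \<phi> p x) d" by auto
    from l2_le_add[OF l2_le_scale[OF \<phi>[of q], of "a q"] this] insert show ?case by auto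
  qed
  then obtain d where sd: "l2_le s d" using P by (auto simp: s_def[abs_def])
  have ss: "(\<Sum>\<^sub>\<infinity>x. s x * s x) = S"
    using infsumI[OF hs[OF sd]] by (simp add: phis S_def power2_eq_square)
  have st: "(\<Sum>\<^sub>\<infinity>x. s x * t x) = S"
    using infsumI[OF hs[OF t]] by (simp add: a_def[symmetric] S_def power2_eq_square)
  have S0: "0 \<le> S" by (simp add: S_def sum_nonneg)
  have "l2_le s (sqrt S)"
    using sd ss by (simp add: l2_le_iff l2norm_def power2_eq_square)
  from l2_le_inner_le[OF this t] have "S \<le> sqrt S * c" using st by simp
  then have *: "sqrt S * sqrt S \<le> sqrt S * c" using S0 by simp
  have "sqrt S \<le> c" if "S \<noteq> 0" using mult_left_le_imp_le[OF *] that S0 by simp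
  then have "sqrt S \<le> c" using l2_le_nonneg[OF t] by (cases "S = 0") auto
  then have "S \<le> c\<^sup>2" using S0 sqrt_le_D by blast
  then show ?thesis by (simp add: S_def a_def)
qed

text \<open>Bessel's inequality is applied for each fixed value of the spectator index
  \<open>y\<close> and then summed over \<open>y\<close>.\<close>

lemma bessel_contraction:
  assumes on: "orthonormal_family \<phi>" and T: "l2_le (\<lambda>(x, y). T x y) c"
  shows "l2_le (\<lambda>(p, y). \<Sum>\<^sub>\<infinity>x. \<phi> p x * T x y) c"
proof (rule l2_leI_sq)
  show "0 \<le> c" by (rule l2_le_nonneg[OF T])
  have T': "l2_le (\<lambda>(y, x). T x y) c"
    by (rule l2_le_pullback[OF T, where h = "\<lambda>(y, x). (x, y)"]) (auto simp: inj_on_def)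
  fix F :: "('a \<times> 'c) set" assume F: "finite F"
  have "(\<Sum>z\<in>F. (case z of (p, y) \<Rightarrow> \<Sum>\<^sub>\<infinity>x. \<phi> p x * T x y)\<^sup>2)
     \<le> (\<Sum>z\<in>fst ` F \<times> snd ` F. (case z of (p, y) \<Rightarrow> \<Sum>\<^sub>\<infinity>x. \<phi> p x * T x y)\<^sup>2)"
    using F by (intro sum_mono2) (simp_all add: subset_fst_snd)
  also have "\<dots> = (\<Sum>y\<in>snd ` F. \<Sum>p\<in>fst ` F. (\<Sum>\<^sub>\<infinity>x. \<phi> p x * T x y)\<^sup>2)"
    by (subst sum.swap) (simp add: sum.cartesian_product split_def)
  also have "\<dots> \<le> (\<Sum>y\<in>snd ` F. (l2norm (\<lambda>x. T x y))\<^sup>2)"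
  proof (rule sum_mono)
    fix y
    have "is_l2 (\<lambda>x. T x y)" using l2_le_slice[OF T', of y] by (simp add: l2_le_iff)
    then show "(\<Sum>p\<in>fst ` F. (\<Sum>\<^sub>\<infinity>x. \<phi> p x * T x y)\<^sup>2) \<le> (l2norm (\<lambda>x. T x y))\<^sup>2"
      by (intro bessel_inequality[OF on] l2_le_slice_norm) (use F in auto)
  qed
  also have "\<dots> \<le> c\<^sup>2" by (rule l2_leD_sq[OF l2_le_l2norm_slices[OF T']]) (use F in auto)
  finally show "(\<Sum>z\<in>F. (case z of (p, y) \<Rightarrow> \<Sum>\<^sub>\<infinity>x. \<phi> p x * T x y)\<^sup>2) \<le> c\<^sup>2" .
qed

lemma orthonormal_family_tensor:
  assumes "orthonormal_family \<phi>" "orthonormal_family \<psi>"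
  shows "orthonormal_family (\<lambda>(p, q) (x, y). \<phi> p x * \<psi> q y)"
proof -
  have l: "l2_le (\<phi> p) 1" "l2_le (\<psi> q) 1" and ip: "(\<Sum>\<^sub>\<infinity>x. \<phi> p x * \<phi> p' x) = of_bool (p = p')"
    "(\<Sum>\<^sub>\<infinity>x. \<psi> q x * \<psi> q' x) = of_bool (q = q')" for p p' q q'
    using assms by (auto simp: orthonormal_family_def)
  have t: "l2_le (\<lambda>(x, y). \<phi> p x * \<psi> q y) 1" for p q
    using l2_le_tensor[OF l] by simp
  have "(\<Sum>\<^sub>\<infinity>(x, y). (\<phi> p x * \<psi> q y) * (\<phi> p' x * \<psi> q' y)) = of_bool (p = p') * of_bool (q = q')" for p p' q q'
    using infsum_prod_mult[of "\<lambda>x. \<phi> p x * \<phi> p' x" "\<lambda>y. \<psi> q y * \<psi> q' y"] l2_le_mult_summable[OF t[of p q] t[of p' q']]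
    by (simp add: split_def mult_ac ip)
  then show ?thesis
    unfolding orthonormal_family_def using t by (auto simp: split_def)
qed

text \<open>The columns are the images of basis vectors, which gives norm 1; orthogonality follows
  by polarization, comparing the norm of the image of a sum of two basis vectors. Only finitely
  supported vectors enter, so the matrix sums are finite.\<close>

lemma isometric_iso_orthonormal:
  assumes "isometric_iso J" shows "orthonormal_family (\<lambda>p I. J I p)"
proof -
  have J: "is_l2 (mat_apply J x)" "l2norm (mat_apply J x) = l2norm x" if "is_l2 x" for x
    using assms that by (auto simp: isometric_iso_def)
  have fin: "(\<Sum>\<^sub>\<infinity>i. (x i)\<^sup>2) = (\<Sum>i\<in>F. (x i)\<^sup>2)" "is_l2 x" "mat_apply J x I = (\<Sum>i\<in>F. J I i * x i)"
    if "finite F" "\<And>i. i \<notin> F \<Longrightarrow> x i = 0" for x F I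
  proof -
    have "(\<Sum>\<^sub>\<infinity>i. (x i)\<^sup>2) = (\<Sum>\<^sub>\<infinity>i\<in>F. (x i)\<^sup>2)" by (rule infsum_cong_neutral) (use that in auto)
    then show "(\<Sum>\<^sub>\<infinity>i. (x i)\<^sup>2) = (\<Sum>i\<in>F. (x i)\<^sup>2)" using that by simp
    show "is_l2 x" unfolding is_l2_def
      by (rule finite_nonzero_values_imp_summable_on, rule finite_subset[OF _ that(1)]) (use that(2) in auto)
    have "mat_apply J x I = (\<Sum>\<^sub>\<infinity>i\<in>F. J I i * x i)"
      unfolding mat_apply_def by (rule infsum_cong_neutral) (use that in auto)
    then show "mat_apply J x I = (\<Sum>i\<in>F. J I i * x i)" using that by simp
  qed
  have sq: "is_l2 (mat_apply J x)" "(\<Sum>\<^sub>\<infinity>I. (mat_apply J x I)\<^sup>2) = (\<Sum>i\<in>F. (x i)\<^sup>2)"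
    if "finite F" "\<And>i. i \<notin> F \<Longrightarrow> x i = 0" for x F
  proof -
    have "sqrt (\<Sum>\<^sub>\<infinity>I. (mat_apply J x I)\<^sup>2) = sqrt (\<Sum>i\<in>F. (x i)\<^sup>2)"
      using J(2)[OF fin(2)[OF that]] by (simp add: l2norm_def fin(1)[OF that])
    then show "is_l2 (mat_apply J x)" "(\<Sum>\<^sub>\<infinity>I. (mat_apply J x I)\<^sup>2) = (\<Sum>i\<in>F. (x i)\<^sup>2)"
      using J(1)[OF fin(2)[OF that]] by auto
  qed
  have col: "mat_apply J (\<lambda>i. of_bool (i = p)) = (\<lambda>I. J I p)" for p
    by (rule ext) (subst fin(3)[where F = "{p}"], auto)
  have n1: "(\<Sum>\<^sub>\<infinity>I. (J I p)\<^sup>2) = 1" and l1: "is_l2 (\<lambda>I. J I p)" for p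
    using sq[of "{p}" "\<lambda>i. of_bool (i = p)"] by (simp_all add: col)
  have l: "l2_le (\<lambda>I. J I p) 1" for p
    using n1[of p] l1[of p] by (simp add: l2_le_iff l2norm_def)
  have "(\<Sum>\<^sub>\<infinity>I. J I p * J I q) = 0" if "p \<noteq> q" for p q
  proof -
    have m: "mat_apply J (\<lambda>i. if i = p \<or> i = q then 1 else 0) = (\<lambda>I. J I p + J I q)"
      by (rule ext) (subst fin(3)[where F = "{p, q}"], use that in auto)
    have "(\<Sum>\<^sub>\<infinity>I. (J I p + J I q)\<^sup>2) = 2"
      using sq(2)[of "{p, q}" "\<lambda>i. if i = p \<or> i = q then 1 else 0"] that by (simp add: m)
    moreover have "(\<Sum>\<^sub>\<infinity>I. (J I p + J I q)\<^sup>2) = (\<Sum>\<^sub>\<infinity>I. (J I p)\<^sup>2 + (J I q)\<^sup>2 + 2 * (J I p * J I q))"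
      by (simp add: power2_sum mult.assoc)
    moreover have "((\<lambda>I. (J I p)\<^sup>2 + (J I q)\<^sup>2 + 2 * (J I p * J I q)) has_sum
        (\<Sum>\<^sub>\<infinity>I. (J I p)\<^sup>2) + (\<Sum>\<^sub>\<infinity>I. (J I q)\<^sup>2) + 2 * (\<Sum>\<^sub>\<infinity>I. J I p * J I q)) UNIV"
      by (intro has_sum_add has_sum_cmult_right has_sum_infsum l2_le_summable_sq[OF l] l2_le_mult_summable[OF l l])
    note infsumI[OF this]
    ultimately show ?thesis by (simp add: n1)
  qed
  then show ?thesis
    unfolding orthonormal_family_def using l n1 by (auto simp: power2_eq_square)
qed

section \<open>The gauge transform and the type I step\<close>

locale leg_isometry =
  fixes J :: "(nat \<times> nat) \<Rightarrow> nat \<Rightarrow> real"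
  assumes orthonormal: "orthonormal_family (\<lambda>p I. J I p)"
    and J_vacuum: "J I 0 = of_bool (I = 0)"
begin

definition push4 :: "(nat \<times> nat, nat \<times> nat, nat \<times> nat, nat \<times> nat) tensor \<Rightarrow> tensor4" where
  "push4 X = (\<lambda>p q r s. \<Sum>\<^sub>\<infinity>(I, Q, K, L). J I p * J Q q * J K r * J L s * X I Q K L)"

definition push2 :: "(nat \<times> nat, nat, nat \<times> nat, nat) tensor \<Rightarrow> tensor4" where
  "push2 X = (\<lambda>i j k l. \<Sum>\<^sub>\<infinity>(P, Q). J P i * J Q k * X P j Q l)"

lemma typeI_eq: "typeI J A = push4 (block A)"
  by (simp add: typeI_def push4_def)

lemma typeII_eq: "typeII J Su Sd = push2 (vcon Sd Su)"
  by (simp add: typeII_def push2_def Umat_eq)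

text \<open>Column 0 is the vacuum basis vector, and every other column is orthogonal to it. Thus
  \<open>J\<close> maps the complement of the vacuum into the complement of the vacuum.\<close>

lemma J_row_vacuum: "J 0 p = of_bool (p = 0)"
proof -
  have "(\<Sum>\<^sub>\<infinity>I. J I p * J I 0) = of_bool (p = 0)"
    using orthonormal by (auto simp: orthonormal_family_def)
  moreover have "(\<Sum>\<^sub>\<infinity>I. J I p * J I 0) = J 0 p"
    by (subst infsum_single[where z = 0]) (auto simp: J_vacuum)
  ultimately show ?thesis by simp
qed

lemma J_nonzero: "J I p \<noteq> 0 \<Longrightarrow> I = 0 \<longleftrightarrow> p = 0"
  using J_vacuum[of I] J_row_vacuum[of p] by (cases "I = 0"; cases "p = 0") auto

lemma orthonormal2: "orthonormal_family (\<lambda>(p, q) (I, Q). J I p * J Q q)"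
  by (rule orthonormal_family_tensor[OF orthonormal orthonormal])

lemma orthonormal4: "orthonormal_family (\<lambda>(p, q, r, s) (I, Q, K, L). J I p * J Q q * J K r * J L s)"
  using orthonormal_family_tensor[OF orthonormal orthonormal_family_tensor[OF orthonormal orthonormal2]]
  by (simp add: split_def mult.assoc)

lemma push4_eq: "push4 X p q r s = (\<Sum>\<^sub>\<infinity>z. (case z of (I, Q, K, L) \<Rightarrow> J I p * J Q q * J K r * J L s) * (case z of (I, Q, K, L) \<Rightarrow> X I Q K L))"
  by (simp add: push4_def split_def)

lemma push2_eq: "push2 X i j k l = (\<Sum>\<^sub>\<infinity>z. (case z of (P, Q) \<Rightarrow> J P i * J Q k) * (case z of (P, Q) \<Rightarrow> X P j Q l))"
  by (simp add: push2_def split_def)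

lemma l2_le_J2: "l2_le (\<lambda>(P, Q). J P i * J Q k) 1"
  using orthonormal2 unfolding orthonormal_family_def by (auto dest!: spec[of _ "(i, k)"])

lemma l2_le_J4: "l2_le (\<lambda>(I, Q, K, L). J I p * J Q q * J K r * J L s) 1"
proof -
  have "l2_le ((\<lambda>(p, q, r, s) (I, Q, K, L). J I p * J Q q * J K r * J L s) (p, q, r, s)) 1"
    using orthonormal4 unfolding orthonormal_family_def by blast
  then show ?thesis by simp
qed

lemma hs_le_push4:
  assumes "hs_le X c" shows "hs_le (push4 X) c"
proof -
  have "l2_le (\<lambda>(z, y::unit). case z of (I, Q, K, L) \<Rightarrow> X I Q K L) c"
    by (rule l2_le_pullback[OF assms[unfolded hs_le_def], where h = fst]) (auto simp: inj_on_def)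
  from bessel_contraction[OF orthonormal4 this] show ?thesis
    unfolding hs_le_def
    by (rule l2_le_pullback[where h = "\<lambda>z. (z, ())"]) (auto simp: inj_on_def push4_eq split_def)
qed

lemma hs_le_push2:
  assumes "hs_le X c" shows "hs_le (push2 X) c"
proof -
  have "l2_le (\<lambda>(z, (j, l)). case z of (P, Q) \<Rightarrow> X P j Q l) c"
    by (rule l2_le_pullback[OF assms[unfolded hs_le_def], where h = "\<lambda>((P, Q), (j, l)). (P, j, Q, l)"])
       (auto simp: inj_on_def)
  then have "l2_le (\<lambda>(z, w). (\<lambda>z (j, l). case z of (P, Q) \<Rightarrow> X P j Q l) z w) c"
    by (simp add: split_def)
  from bessel_contraction[OF orthonormal2 this] show ?thesis
    unfolding hs_le_def
    by (rule l2_le_pullback[where h = "\<lambda>(i, j, k, l). ((i, k), (j, l))"]) (auto simp: inj_on_def push2_eq split_def)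
qed

lemma push4_add:
  assumes "hs_le X a" "hs_le Y b" shows "push4 (X + Y) = push4 X + push4 Y"
proof (intro ext)
  fix p q r s
  show "push4 (X + Y) p q r s = (push4 X + push4 Y) p q r s"
    using infsum_add[OF l2_le_mult_summable[OF l2_le_J4 assms(1)[unfolded hs_le_def]]
        l2_le_mult_summable[OF l2_le_J4 assms(2)[unfolded hs_le_def]], of p q r s p q r s]
    by (simp add: push4_eq split_def distrib_left)
qed

lemma push2_add:
  assumes "hs_le X a" "hs_le Y b" shows "push2 (X + Y) = push2 X + push2 Y"
proof (intro ext)
  fix i j k l
  show "push2 (X + Y) i j k l = (push2 X + push2 Y) i j k l"
    using infsum_add[OF l2_le_mult_summable[OF l2_le_J2 hs_le_slices(6)[OF assms(1)]]
        l2_le_mult_summable[OF l2_le_J2 hs_le_slices(6)[OF assms(2)]], of i k j l i k j l]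
    by (simp add: push2_eq split_def distrib_left)
qed

lemma push4_unit: "push4 unit4 = unit4"
  unfolding push4_eq fun_eq_iff
  by (intro allI, subst infsum_single[where z = 0])
     (auto simp: zero_prod_def[symmetric] unit4_def J_row_vacuum split_def prod_eq_0_iff)

lemma push2_unit: "push2 unit4 = unit4"
  unfolding push2_eq fun_eq_iff
  by (intro allI, subst infsum_single[where z = 0])
     (auto simp: zero_prod_def[symmetric] unit4_def J_row_vacuum split_def prod_eq_0_iff)

text \<open>A nonzero sum has a nonzero term, and a nonzero entry of \<open>J\<close> joins vacuum
  to vacuum or non-vacuum to non-vacuum. Statements about which legs vanish therefore pass through
  the type I step.\<close>

lemma push4_support:
  assumes "push4 X p q r s \<noteq> 0"
  obtains I Q K L where "X I Q K L \<noteq> 0" "I = 0 \<longleftrightarrow> p = 0" "Q = 0 \<longleftrightarrow> q = 0" "K = 0 \<longleftrightarrow> r = 0" "L = 0 \<longleftrightarrow> s = 0"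
proof -
  have "\<exists>z. (case z of (I, Q, K, L) \<Rightarrow> J I p * J Q q * J K r * J L s) * (case z of (I, Q, K, L) \<Rightarrow> X I Q K L) \<noteq> 0"
    using assms infsum_0[of UNIV "\<lambda>z. (case z of (I, Q, K, L) \<Rightarrow> J I p * J Q q * J K r * J L s) * (case z of (I, Q, K, L) \<Rightarrow> X I Q K L)"]
    unfolding push4_eq by blast
  then obtain I Q K L where "J I p * J Q q * J K r * J L s * X I Q K L \<noteq> 0" by auto
  then show ?thesis using that[of I Q K L] J_nonzero by auto
qed

end

section \<open>First-order expansions of rows and blocks, and the gauge and type I steps\<close>

definition hlin :: "(nat, nat, nat, nat) tensor \<Rightarrow> (nat, nat \<times> nat, nat, nat \<times> nat) tensor" where
  "hlin \<kappa> = hcon \<kappa> unit4 + hcon unit4 \<kappa>"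

lemma hs_le_hlin: "hs_le \<kappa> a \<Longrightarrow> hs_le (hlin \<kappa>) (2 * a)"
  unfolding hlin_def using hs_le_add[OF hs_le_hcon[OF _ hs_le_unit] hs_le_hcon[OF hs_le_unit], of \<kappa> a \<kappa> a] by simp

text \<open>The first-order part of a row has \<open>\<kappa>\<close> on one site and the vacuum on
  the other, which is \<open>hlin\<close>. In the remainder, two terms contain \<open>\<rho>\<close>
  against a factor of norm at most 2, giving \<open>4 * b\<close>, and the product of
  \<open>\<kappa>\<close> with itself gives \<open>a * a\<close>.\<close>

lemma hcon_perturb:
  assumes \<kappa>: "hs_le \<kappa> a" and \<rho>: "hs_le \<rho> b" and ab: "a + b \<le> 1"
  obtains r where "hcon (unit4 + \<kappa> + \<rho>) (unit4 + \<kappa> + \<rho>) = unit4 + hlin \<kappa> + r" "hs_le r (4 * b + a * a)"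
proof
  note [simp] = hs_le_nonneg[OF \<kappa>] hs_le_nonneg[OF \<rho>]
  have u: "hs_le (unit4 :: (nat, nat, nat, nat) tensor) 1" by (rule hs_le_unit)
  have u\<kappa>: "hs_le (unit4 + \<kappa>) 2" by (rule hs_le_mono[OF hs_le_add[OF u \<kappa>]]) (use ab hs_le_nonneg[OF \<rho>] in linarith)
  have A: "hs_le (unit4 + \<kappa> + \<rho>) 2" by (rule hs_le_mono[OF hs_le_add[OF hs_le_add[OF u \<kappa>] \<rho>]]) (use ab in simp)
  let ?r = "hcon (unit4 + \<kappa>) \<rho> + hcon \<rho> (unit4 + \<kappa> + \<rho>) + hcon \<kappa> \<kappa>"
  have "hcon (unit4 + \<kappa> + \<rho>) (unit4 + \<kappa> + \<rho>) = hcon (unit4 + \<kappa>) (unit4 + \<kappa>) + hcon (unit4 + \<kappa>) \<rho> + hcon \<rho> (unit4 + \<kappa> + \<rho>)"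
    by (subst hcon_add_left[OF u\<kappa> \<rho> A], subst hcon_add_right[OF u\<kappa> u\<kappa> \<rho>]) simp
  also have "hcon (unit4 + \<kappa>) (unit4 + \<kappa>) = hcon (unit4 :: tensor4) (unit4 :: tensor4) + hcon unit4 \<kappa> + (hcon \<kappa> unit4 + hcon \<kappa> \<kappa>)"
    by (simp only: hcon_add_left[OF u \<kappa> u\<kappa>] hcon_add_right[OF u u \<kappa>] hcon_add_right[OF \<kappa> u \<kappa>])
  finally have eq: "hcon (unit4 + \<kappa> + \<rho>) (unit4 + \<kappa> + \<rho>) = hcon (unit4 :: tensor4) (unit4 :: tensor4) + hcon unit4 \<kappa>
      + (hcon \<kappa> unit4 + hcon \<kappa> \<kappa>) + hcon (unit4 + \<kappa>) \<rho> + hcon \<rho> (unit4 + \<kappa> + \<rho>)" .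
  show "hcon (unit4 + \<kappa> + \<rho>) (unit4 + \<kappa> + \<rho>) = unit4 + hlin \<kappa> + ?r"
    unfolding eq hlin_def hcon_unit_unit by (simp only: ac_simps)
  show "hs_le ?r (4 * b + a * a)"
    by (rule hs_le_mono[OF hs_le_add[OF hs_le_add[OF hs_le_hcon[OF u\<kappa> \<rho>] hs_le_hcon[OF \<rho> A]] hs_le_hcon[OF \<kappa> \<kappa>]]]) simp
qed

lemma vcon_perturb:
  fixes \<kappa> \<rho> :: "(nat, nat \<times> nat, nat, nat \<times> nat) tensor"
  assumes \<kappa>: "hs_le \<kappa> a" and \<rho>: "hs_le \<rho> b" and ab: "a + b \<le> 1"
  obtains r where "vcon (unit4 + \<kappa> + \<rho>) (unit4 + \<kappa> + \<rho>) = unit4 + (vcon \<kappa> unit4 + vcon unit4 \<kappa>) + r"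
    "hs_le r (4 * b + a * a)"
proof
  note [simp] = hs_le_nonneg[OF \<kappa>] hs_le_nonneg[OF \<rho>]
  have u: "hs_le (unit4 :: (nat, nat \<times> nat, nat, nat \<times> nat) tensor) 1" by (rule hs_le_unit)
  have u\<kappa>: "hs_le (unit4 + \<kappa>) 2" by (rule hs_le_mono[OF hs_le_add[OF u \<kappa>]]) (use ab hs_le_nonneg[OF \<rho>] in linarith)
  have A: "hs_le (unit4 + \<kappa> + \<rho>) 2" by (rule hs_le_mono[OF hs_le_add[OF hs_le_add[OF u \<kappa>] \<rho>]]) (use ab in simp)
  let ?r = "vcon (unit4 + \<kappa>) \<rho> + vcon \<rho> (unit4 + \<kappa> + \<rho>) + vcon \<kappa> \<kappa>"
  have "vcon (unit4 + \<kappa> + \<rho>) (unit4 + \<kappa> + \<rho>) = vcon (unit4 + \<kappa>) (unit4 + \<kappa>) + vcon (unit4 + \<kappa>) \<rho> + vcon \<rho> (unit4 + \<kappa> + \<rho>)"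
    by (subst vcon_add_left[OF u\<kappa> \<rho> A], subst vcon_add_right[OF u\<kappa> u\<kappa> \<rho>]) simp
  also have "vcon (unit4 + \<kappa>) (unit4 + \<kappa>) = vcon (unit4 :: (nat, nat \<times> nat, nat, nat \<times> nat) tensor) unit4 + vcon unit4 \<kappa> + (vcon \<kappa> unit4 + vcon \<kappa> \<kappa>)"
    by (simp only: vcon_add_left[OF u \<kappa> u\<kappa>] vcon_add_right[OF u u \<kappa>] vcon_add_right[OF \<kappa> u \<kappa>])
  finally have eq: "vcon (unit4 + \<kappa> + \<rho>) (unit4 + \<kappa> + \<rho>) = vcon (unit4 :: (nat, nat \<times> nat, nat, nat \<times> nat) tensor) unit4 + vcon unit4 \<kappa>
      + (vcon \<kappa> unit4 + vcon \<kappa> \<kappa>) + vcon (unit4 + \<kappa>) \<rho> + vcon \<rho> (unit4 + \<kappa> + \<rho>)" .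
  show "vcon (unit4 + \<kappa> + \<rho>) (unit4 + \<kappa> + \<rho>) = unit4 + (vcon \<kappa> unit4 + vcon unit4 \<kappa>) + ?r"
    unfolding eq vcon_unit_unit by (simp only: ac_simps)
  show "hs_le ?r (4 * b + a * a)"
    by (rule hs_le_mono[OF hs_le_add[OF hs_le_add[OF hs_le_vcon[OF u\<kappa> \<rho>] hs_le_vcon[OF \<rho> A]] hs_le_vcon[OF \<kappa> \<kappa>]]]) simp
qed

text \<open>This is the cancellation mechanism shared by the gauge transform and the disentangler:
  acting on the vacuum, the shear subtracts a prescribed row and its inverse (next lemma) a
  prescribed column, up to a second-order multiple of the vacuum.\<close>

lemma Lact_shear_unit:
  assumes "M 0 = 0"
  shows "Lact (shear N M) unit4 = - rowt N - scale4 (\<Sum>\<^sub>\<infinity>x. N x * M x) unit4"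
  by (auto simp: Lact_unit shear_def rowt_def scale4_def unit4_def fun_eq_iff assms)

lemma Ract_shear_inv_unit:
  assumes "N 0 = 0"
  shows "Ract (shear_inv N M) unit4 = - colt M"
  by (auto simp: Ract_unit shear_inv_def colt_def fun_eq_iff assms)

lemma gauge_horizontal:
  "gauge (id_plus g) (id_plus h) (id_plus (\<lambda>_ _. 0)) (id_plus (\<lambda>_ _. 0)) A i j k l
   = (\<Sum>\<^sub>\<infinity>(i', k'). id_plus g i' i * A i' j k' l * id_plus h k k')"
proof -
  let ?f = "\<lambda>(i', j', k', l'). id_plus g i' i * id_plus (\<lambda>_ _. 0) j' j * id_plus h k k' * id_plus (\<lambda>_ _. 0) l l' * A i' j' k' l'"
  have "infsum ?f UNIV = infsum ?f ((\<lambda>(i', k'). (i', j, k', l)) ` UNIV)"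
    by (rule infsum_cong_neutral) (auto simp: id_plus_def image_iff)
  also have "\<dots> = (\<Sum>\<^sub>\<infinity>(i', k'). id_plus g i' i * A i' j k' l * id_plus h k k')"
    by (subst infsum_reindex) (auto simp: inj_on_def id_plus_def o_def split_def mult_ac)
  finally show ?thesis by (simp add: gauge_def)
qed

lemma id_inv_pair: "bounded_inv_pair (id_plus (\<lambda>(_::'a) (_::'a). 0)) (id_plus (\<lambda>_ _. 0))"
proof -
  have "l2_le (\<lambda>(i::'a, j::'a). 0::real) 0" using l2_le_zero[of 0] by (simp add: split_def)
  note B = bounded_mat_id_plus[OF this]
  show ?thesis unfolding bounded_inv_pair_def using B by simp
qed

lemma gauge_step:
  assumes B: "hs_le B t" and t: "t \<le> 1" and B0: "B 0 0 0 0 = 0" and A: "A = unit4 + B"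
  obtains Gh Ghi Gv Gvi \<kappa> \<rho> where "bounded_inv_pair Gh Ghi" "bounded_inv_pair Gv Gvi"
    "gauge Gh Ghi Gv Gvi A = unit4 + \<kappa> + \<rho>" "hs_le \<kappa> t" "hs_le \<rho> (25 * t\<^sup>2)"
    "\<And>i k. \<kappa> i 0 k 0 \<noteq> 0 \<Longrightarrow> i \<noteq> 0 \<and> k \<noteq> 0"
proof -
  \<comment> \<open>\<open>u\<close> and \<open>w\<close> collect the entries of \<open>B\<close>
    whose only nonzero leg is the right one, respectively the left one. The shear built from them
    subtracts exactly these from the vacuum part of \<open>A\<close>.\<close>
  define u where "u i = (if i = 0 then 0 else B i 0 0 0)" for i
  define w where "w k = (if k = 0 then 0 else B 0 0 k 0)" for k
  define g where "g = shear u w"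
  define h where "h = shear_inv u w"
  define \<nu> where "\<nu> = (\<Sum>\<^sub>\<infinity>x. u x * w x)"
  have t0: "0 \<le> t" by (rule hs_le_nonneg[OF B])
  have tt: "t * t \<le> t" using mult_left_mono[OF t t0] by simp
  have u: "l2_le u t" by (rule l2_le_pullback[OF hs_le_slices(1)[OF B, of 0 0 0], where h = id]) (auto simp: u_def)
  have w: "l2_le w t" by (rule l2_le_pullback[OF hs_le_slices(3)[OF B, of 0 0 0], where h = id]) (auto simp: w_def)
  have \<nu>: "\<bar>\<nu>\<bar> \<le> t * t" unfolding \<nu>_def by (rule l2_le_inner_le[OF u w])
  have u0: "u 0 = 0" and w0: "w 0 = 0" by (auto simp: u_def w_def)
  have g: "hs_le (mat_tensor g) (3 * t)"
    unfolding g_def mat_tensor_shear \<nu>_def[symmetric]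
    by (rule hs_le_mono[OF hs_le_diff[OF hs_le_diff[OF hs_le_colt[OF w] hs_le_rowt[OF u]] hs_le_scale[OF hs_le_unit]]]) (use \<nu> tt in simp)
  have h: "hs_le (mat_tensor h) (3 * t)"
    unfolding h_def mat_tensor_shear_inv
    by (rule hs_le_mono[OF hs_le_diff[OF hs_le_diff[OF hs_le_rowt[OF u] hs_le_colt[OF w]] hs_le_Lact[OF hs_le_colt[OF w]]]])
       (use tt in \<open>auto simp: mat_tensor_row hs_le_rowt u\<close>)
  have E: "hs_le (unit4 :: tensor4) 1" by (rule hs_le_unit)
  have A2: "hs_le A 2" unfolding A by (rule hs_le_mono[OF hs_le_add[OF E B]]) (use t in simp)
  define \<kappa> where "\<kappa> = B - rowt u - colt w"
  define Z where "Z = Lact g (Ract h A)"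
  define \<rho> where "\<rho> = Ract h B + Lact g B + Z - scale4 \<nu> unit4"
  have eq: "gauge (id_plus g) (id_plus h) (id_plus (\<lambda>_ _. 0)) (id_plus (\<lambda>_ _. 0)) A = unit4 + \<kappa> + \<rho>"
  proof -
    have "gauge (id_plus g) (id_plus h) (id_plus (\<lambda>_ _. 0)) (id_plus (\<lambda>_ _. 0)) A
        = A + Ract h A + (Lact g A + Z)"
      unfolding Z_def by (intro ext) (simp only: gauge_horizontal conj_expand[OF A2 g h])
    moreover have "Ract h A = - colt w + Ract h B"
      unfolding A Ract_add[OF E B h] by (simp add: h_def Ract_shear_inv_unit u0)
    moreover have "Lact g A = - rowt u - scale4 \<nu> unit4 + Lact g B"
      unfolding A Lact_add[OF E B g] by (simp add: g_def Lact_shear_unit w0 \<nu>_def)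
    ultimately have "gauge (id_plus g) (id_plus h) (id_plus (\<lambda>_ _. 0)) (id_plus (\<lambda>_ _. 0)) A
        = unit4 + B + (- colt w + Ract h B) + (- rowt u - scale4 \<nu> unit4 + Lact g B + Z)"
      using A by metis
    then show ?thesis unfolding \<kappa>_def \<rho>_def by (simp add: algebra_simps)
  qed
  \<comment> \<open>The entry at the origin belongs to neither \<open>u\<close> nor
    \<open>w\<close>; it is zero because \<open>B\<close> vanishes there by the normalization of
    \<open>A\<close>.\<close>
  have \<kappa>_eq: "\<kappa> i j k l = (if j = 0 \<and> l = 0 \<and> (i = 0 \<or> k = 0) then 0 else B i j k l)" for i j k l
    using B0 by (auto simp: \<kappa>_def rowt_def colt_def u_def w_def)
  have \<kappa>: "hs_le \<kappa> t" by (rule hs_le_le[OF B]) (simp add: \<kappa>_eq)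
  \<comment> \<open>The constant is 3 + 3 from the two one-sided actions on \<open>B\<close>, 3 * 2
    * 3 = 18 from the two-sided action on \<open>A\<close>, and 1 from \<open>\<nu>\<close>.\<close>
  have \<rho>: "hs_le \<rho> (25 * t\<^sup>2)"
    unfolding \<rho>_def Z_def
    by (rule hs_le_mono[OF hs_le_diff[OF hs_le_add[OF hs_le_add[OF hs_le_Ract[OF B h] hs_le_Lact[OF B g]] hs_le_Lact[OF hs_le_Ract[OF A2 h] g]] hs_le_scale[OF hs_le_unit]]])
       (use \<nu> in \<open>simp add: power2_eq_square\<close>)
  show ?thesis
    by (rule that[OF shear_id_plus_inv_pair[OF u u0 w w0, folded g_def h_def] id_inv_pair eq \<kappa> \<rho>])
       (auto simp: \<kappa>_eq split: if_splits)
qed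

text \<open>Expand the rows, then the stack of rows. The linear part doubles twice, to
  \<open>4 * t\<close>; the quadratic constants are 4 * 25 + 1 = 101 for a row and 4 * 101 + 2 * 2 =
  408 for the block.\<close>

lemma (in leg_isometry) typeI_step:
  assumes A: "A = unit4 + \<kappa> + \<rho>" and \<kappa>: "hs_le \<kappa> t" and \<rho>: "hs_le \<rho> (25 * t\<^sup>2)" and t: "t \<le> 1 / 200"
    and \<kappa>0: "\<And>i k. \<kappa> i 0 k 0 \<noteq> 0 \<Longrightarrow> i \<noteq> 0 \<and> k \<noteq> 0"
  obtains \<kappa>' \<rho>' where "typeI J A = unit4 + \<kappa>' + \<rho>'" "hs_le \<kappa>' (4 * t)" "hs_le \<rho>' (408 * t\<^sup>2)"
    "\<And>i j k l. \<kappa>' i j k l \<noteq> 0 \<Longrightarrow> (i = 0 \<or> k = 0) \<and> (j = 0 \<longleftrightarrow> l \<noteq> 0)"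
proof -
  have t0: "0 \<le> t" by (rule hs_le_nonneg[OF \<kappa>])
  have tt: "t\<^sup>2 \<le> t / 200" using mult_left_mono[OF t t0] by (simp add: power2_eq_square)
  have A2: "hs_le A 2" unfolding A by (rule hs_le_mono[OF hs_le_add[OF hs_le_add[OF hs_le_unit \<kappa>] \<rho>]]) (use t tt in simp)
  obtain r where W: "hcon A A = unit4 + hlin \<kappa> + r" and r: "hs_le r (4 * (25 * t\<^sup>2) + t * t)"
    unfolding A by (rule hcon_perturb[OF \<kappa> \<rho>]) (use t tt in simp)
  have r: "hs_le r (101 * t\<^sup>2)" by (rule hs_le_mono[OF r]) (simp add: power2_eq_square)
  note \<lambda> = hs_le_hlin[OF \<kappa>]
  obtain r' where T: "vcon (hcon A A) (hcon A A) = unit4 + (vcon (hlin \<kappa>) unit4 + vcon unit4 (hlin \<kappa>)) + r'"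
    and r': "hs_le r' (4 * (101 * t\<^sup>2) + (2 * t) * (2 * t))"
    unfolding W by (rule vcon_perturb[OF \<lambda> r]) (use t tt in simp)
  have r': "hs_le r' (408 * t\<^sup>2)" by (rule hs_le_mono[OF r']) (simp add: power2_eq_square)
  let ?k = "vcon (hlin \<kappa>) unit4 + vcon unit4 (hlin \<kappa>)"
  have k: "hs_le ?k (4 * t)"
    by (rule hs_le_mono[OF hs_le_add[OF hs_le_vcon[OF \<lambda> hs_le_unit] hs_le_vcon[OF hs_le_unit \<lambda>]]]) simp
  have "typeI J A = push4 (unit4 + ?k + r')" by (simp add: typeI_eq block_eq[OF A2] T)
  also have "\<dots> = unit4 + push4 ?k + push4 r'"
    using push4_add[OF hs_le_add[OF hs_le_unit k] r'] push4_add[OF hs_le_unit k] by (simp add: push4_unit)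
  finally have 1: "typeI J A = unit4 + push4 ?k + push4 r'" .
  \<comment> \<open>The vacuum row sets the cut legs of the other row to 0, and the vacuum site in
    that row sets one of its horizontal legs to 0. If the remaining vertical leg were 0 too,
    \<open>\<kappa>\<close> would be evaluated at an entry excluded by
    \<open>\<kappa>0\<close>.\<close>
  have supp: "(I = 0 \<or> K = 0) \<and> (Q = 0 \<longleftrightarrow> L \<noteq> 0)" if "?k I Q K L \<noteq> 0" for I Q K L
  proof -
    have a: "(i = 0 \<or> k = 0) \<and> j \<noteq> 0" if "hlin \<kappa> i j k 0 \<noteq> 0" for i j k
      using that \<kappa>0 by (cases "fst j = 0"; cases "snd j = 0")
        (auto simp: hlin_def hcon_unit_left hcon_unit_right prod_eq_0_iff split: if_splits)
    have b: "(i = 0 \<or> k = 0) \<and> l \<noteq> 0" if "hlin \<kappa> i 0 k l \<noteq> 0" for i k l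
      using that \<kappa>0 by (cases "fst l = 0"; cases "snd l = 0")
        (auto simp: hlin_def hcon_unit_left hcon_unit_right prod_eq_0_iff split: if_splits)
    have "vcon (hlin \<kappa>) unit4 I Q K L \<noteq> 0 \<or> vcon unit4 (hlin \<kappa>) I Q K L \<noteq> 0"
      using that by auto
    then show ?thesis
    proof
      assume "vcon (hlin \<kappa>) unit4 I Q K L \<noteq> 0"
      then show ?thesis using a[of "fst I" Q "fst K"]
        by (auto simp: vcon_unit_right prod_eq_0_iff[of I] prod_eq_0_iff[of K] split: if_splits)
    next
      assume "vcon unit4 (hlin \<kappa>) I Q K L \<noteq> 0"
      then show ?thesis using b[of "snd I" "snd K" L]
        by (auto simp: vcon_unit_left prod_eq_0_iff[of I] prod_eq_0_iff[of K] split: if_splits)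
    qed
  qed
  show ?thesis
  proof (rule that[OF 1 hs_le_push4[OF k] hs_le_push4[OF r']])
    fix i j k l assume "push4 ?k i j k l \<noteq> 0"
    then obtain I Q K L where "?k I Q K L \<noteq> 0" "I = 0 \<longleftrightarrow> i = 0" "Q = 0 \<longleftrightarrow> j = 0" "K = 0 \<longleftrightarrow> k = 0" "L = 0 \<longleftrightarrow> l = 0"
      by (rule push4_support)
    then show "(i = 0 \<or> k = 0) \<and> (j = 0 \<longleftrightarrow> l \<noteq> 0)" using supp by metis
  qed
qed

section \<open>The disentangler and the factorization\<close>

definition bot0 :: "('a, 'b, 'c, 'd::zero) tensor \<Rightarrow> ('a, 'b, 'c, 'd) tensor" where
  "bot0 X = (\<lambda>i j k m. if m = 0 then X i j k m else 0)"

definition top0 :: "('a, 'b::zero, 'c, 'd) tensor \<Rightarrow> ('a, 'b, 'c, 'd) tensor" where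
  "top0 X = (\<lambda>i m k l. if m = 0 then X i m k l else 0)"

lemma hs_le_bot0: "hs_le X a \<Longrightarrow> hs_le (bot0 X) a"
  by (rule hs_le_le[of X]) (auto simp: bot0_def)

lemma hs_le_top0: "hs_le X a \<Longrightarrow> hs_le (top0 X) a"
  by (rule hs_le_le[of X]) (auto simp: top0_def)

lemma hs_le_diff_bot0: "hs_le X a \<Longrightarrow> hs_le (X - bot0 X) a"
  by (rule hs_le_le[of X]) (auto simp: bot0_def)

lemma hs_le_diff_top0: "hs_le X a \<Longrightarrow> hs_le (X - top0 X) a"
  by (rule hs_le_le[of X]) (auto simp: top0_def)

lemma vcon_bot0_diff_top0: "vcon (bot0 X) (Y - top0 Y) = 0"
  unfolding vcon_def bot0_def top0_def by (intro ext) (simp add: infsum_0)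

lemma vcon_diff_bot0_top0: "vcon (X - bot0 X) (top0 Y) = 0"
  unfolding vcon_def bot0_def top0_def by (intro ext) (simp add: infsum_0)

text \<open>The mixed terms vanish because one factor lives on bond value 0 and the other on its
  complement.\<close>

lemma vcon_cut:
  assumes X: "hs_le X a" and Y: "hs_le Y b"
  shows "vcon X Y = vcon (bot0 X) (top0 Y) + vcon (X - bot0 X) (Y - top0 Y)"
proof -
  note b = hs_le_bot0[OF X] hs_le_diff_bot0[OF X] hs_le_top0[OF Y] hs_le_diff_top0[OF Y]
  have "vcon X Y = vcon (bot0 X + (X - bot0 X)) (top0 Y + (Y - top0 Y))" by simp
  also have "\<dots> = vcon (bot0 X) (top0 Y) + vcon (bot0 X) (Y - top0 Y) + (vcon (X - bot0 X) (top0 Y) + vcon (X - bot0 X) (Y - top0 Y))"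
    by (simp only: vcon_add_left[OF b(1,2) hs_le_add[OF b(3,4)]] vcon_add_right[OF b(1,3,4)] vcon_add_right[OF b(2,3,4)])
  finally show ?thesis by (simp add: vcon_bot0_diff_top0 vcon_diff_bot0_top0)
qed

text \<open>The disentangler is assembled from such rows and columns of \<open>P\<close>. A
  Hilbert-Schmidt bound on it would not suffice, since what it leaves behind has to be factored
  again.\<close>

lemma nuclear_rowt:
  fixes P :: "('a::zero \<times> 'e::zero, 'b::zero, 'c::zero \<times> 'f::zero, 'g::zero) tensor"
  assumes "nuclear P c"
  shows "nuclear (rowt (\<lambda>I. P I 0 0 0) :: ('a \<times> 'e, nat, 'a \<times> 'e, nat) tensor) c"
  by (rule nuclear_pullback[OF assms, where P = "\<lambda>i j k. j = 0 \<and> k = 0" and Q = "\<lambda>i k l. k = 0 \<and> l = 0"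
        and p = "\<lambda>(i, j, k). (i, 0, 0)" and q = "\<lambda>(i, k, l). (i, 0, 0)"])
     (auto simp: inj_on_def rowt_def zero_prod_def)

lemma nuclear_colt:
  fixes P :: "('a::zero \<times> 'e::zero, 'b::zero, 'c::zero \<times> 'f::zero, 'g::zero) tensor"
  assumes "nuclear P c"
  shows "nuclear (colt (\<lambda>K. P 0 0 K 0) :: ('c \<times> 'f, nat, 'c \<times> 'f, nat) tensor) c"
  by (rule nuclear_pullback[OF assms, where P = "\<lambda>i j k. i = 0 \<and> j = 0" and Q = "\<lambda>i k l. i = 0 \<and> l = 0"
        and p = "\<lambda>(i, j, k). (0, 0, k)" and q = "\<lambda>(i, k, l). (0, k, 0)"])
     (auto simp: inj_on_def colt_def zero_prod_def)

text \<open>Bond value 0 will carry the two truncated rows, and the positive values, shifted by one,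
  a factorization of the remainder.\<close>

lemma vcon_zero_Suc:
  assumes "hs_le U a" "hs_le V b"
  shows "vcon U V = (\<lambda>i j k l. U (fst i) j (fst k) 0 * V (snd i) 0 (snd k) l)
     + vcon (\<lambda>i j k n. U i j k (Suc n)) (\<lambda>i n k l. V i (Suc n) k l)"
proof (intro ext)
  fix i j k l
  let ?f = "\<lambda>m. U (fst i) j (fst k) m * V (snd i) m (snd k) l"
  have s: "?f summable_on UNIV" by (rule vcon_summable[OF assms])
  have "vcon U V i j k l = infsum ?f ({0} \<union> range Suc)"
    by (simp add: vcon_def UNIV_nat_eq[symmetric])
  also have "\<dots> = infsum ?f {0} + infsum ?f (range Suc)"
    by (rule infsum_Un_disjoint) (auto intro: summable_on_subset_banach[OF s])
  finally show "vcon U V i j k l = ((\<lambda>i j k l. U (fst i) j (fst k) 0 * V (snd i) 0 (snd k) l)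
     + vcon (\<lambda>i j k n. U i j k (Suc n)) (\<lambda>i n k l. V i (Suc n) k l)) i j k l"
    by (simp add: infsum_reindex o_def vcon_def)
qed

lemma vcon_bot0_top0: "vcon (bot0 X) (top0 Y) = (\<lambda>i j k l. X (fst i) j (fst k) 0 * Y (snd i) 0 (snd k) l)"
  unfolding vcon_def by (intro ext, subst infsum_single[where z = 0]) (auto simp: bot0_def top0_def)

text \<open>In each term of \<open>hlin \<kappa>\<close> one site is the vacuum: with
  \<open>\<kappa>\<close> on the left site the legs of the right site vanish, and conversely. The
  two alternatives in the second conclusion are these two positions.\<close>

lemma hlin_support:
  assumes \<kappa>: "\<And>i j k l. \<kappa> i j k l \<noteq> 0 \<Longrightarrow> (i = 0 \<or> k = 0) \<and> (j = 0 \<longleftrightarrow> l \<noteq> 0)"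
    and "hlin \<kappa> i j k m \<noteq> 0"
  shows "j = 0 \<longleftrightarrow> m \<noteq> 0"
    and "(i = 0 \<and> snd j = 0 \<and> snd m = 0) \<or> (k = 0 \<and> fst j = 0 \<and> fst m = 0)"
proof -
  have "hcon \<kappa> unit4 i j k m \<noteq> 0 \<or> hcon unit4 \<kappa> i j k m \<noteq> 0"
    using assms(2) by (auto simp: hlin_def)
  then have *: "i = 0 \<and> snd j = 0 \<and> snd m = 0 \<and> \<kappa> 0 (fst j) k (fst m) \<noteq> 0 \<or>
      fst j = 0 \<and> k = 0 \<and> fst m = 0 \<and> \<kappa> i (snd j) 0 (snd m) \<noteq> 0"
    by (auto simp: hcon_unit_left hcon_unit_right split: if_splits)
  then show "j = 0 \<longleftrightarrow> m \<noteq> 0"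
    using \<kappa>[of 0 "fst j" k "fst m"] \<kappa>[of i "snd j" 0 "snd m"] unfolding prod_eq_0_iff by metis
  show "(i = 0 \<and> snd j = 0 \<and> snd m = 0) \<or> (k = 0 \<and> fst j = 0 \<and> fst m = 0)"
    using * by blast
qed

text \<open>In the output, \<open>\<alpha>\<close> and \<open>\<alpha>'\<close> are the first-order
  entries of the rows at bond value 0. They vanish when the outer vertical leg is 0, which is the
  property needed when the factors are glued the other way round.\<close>

lemma factorization_step:
  assumes A: "A = unit4 + \<kappa> + \<rho>" and \<kappa>: "hs_le \<kappa> (4 * t)" and \<rho>: "hs_le \<rho> (408 * t\<^sup>2)" and t: "t \<le> 1 / 2000"
    and supp: "\<And>i j k l. \<kappa> i j k l \<noteq> 0 \<Longrightarrow> (i = 0 \<or> k = 0) \<and> (j = 0 \<longleftrightarrow> l \<noteq> 0)"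
  obtains R Ri \<alpha> \<beta> \<alpha>' \<beta>' and Su :: "(nat, nat \<times> nat, nat, nat) tensor" and Sd where "bounded_inv_pair R Ri"
    "conjR R Ri (block A) = vcon Su Sd"
    "Su = unit4 + \<alpha> + \<beta>" "hs_le \<alpha> (8 * t)" "hs_le \<beta> (2000 * sqrt (t ^ 3))" "\<And>i k m. \<alpha> i 0 k m = 0"
    "Sd = unit4 + \<alpha>' + \<beta>'" "hs_le \<alpha>' (8 * t)" "hs_le \<beta>' (2000 * sqrt (t ^ 3))" "\<And>i m k. \<alpha>' i m k 0 = 0"
proof -
  have t0: "0 \<le> t" using hs_le_nonneg[OF \<kappa>] by simp
  have t2: "0 \<le> t\<^sup>2" "t\<^sup>2 \<le> t / 2000" using mult_left_mono[OF t t0] by (simp_all add: power2_eq_square)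
  have t3: "0 \<le> t ^ 3" using t0 by simp
  have t4: "0 \<le> t ^ 4" "t ^ 4 \<le> t ^ 3 / 2000"
    using mult_left_mono[OF t t3] t0 by (simp_all add: power_numeral_reduce mult_ac)
  have t42: "t ^ 4 \<le> t\<^sup>2 / 4000000"
    using mult_left_mono[OF power_mono[OF t t0, of 2] t2(1)]
    by (simp add: power_numeral_reduce power_divide mult_ac)
  have q: "t\<^sup>2 \<le> sqrt (t ^ 3)"
  proof (rule real_le_rsqrt)
    have "(t\<^sup>2)\<^sup>2 = t ^ 4" by simp
    then show "(t\<^sup>2)\<^sup>2 \<le> t ^ 3" using t4 t3 by linarith
  qed
  have A2: "hs_le A 2" unfolding A by (rule hs_le_mono[OF hs_le_add[OF hs_le_add[OF hs_le_unit \<kappa>] \<rho>]]) (use t t2 in linarith)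
  define \<mu> where "\<mu> = hlin \<kappa>"
  have \<mu>: "hs_le \<mu> (8 * t)" unfolding \<mu>_def by (rule hs_le_mono[OF hs_le_hlin[OF \<kappa>]]) simp
  have \<mu>_supp: "j = 0 \<longleftrightarrow> m \<noteq> 0"
      "(i = 0 \<and> snd j = 0 \<and> snd m = 0) \<or> (k = 0 \<and> fst j = 0 \<and> fst m = 0)" if "\<mu> i j k m \<noteq> 0" for i j k m
    by (rule hlin_support[of \<kappa>]; use supp that in \<open>simp add: \<mu>_def\<close>)+
  obtain r where W_eq: "hcon A A = unit4 + \<mu> + r" and r: "hs_le r (4 * (408 * t\<^sup>2) + 4 * t * (4 * t))"
    unfolding A \<mu>_def by (rule hcon_perturb[OF \<kappa> \<rho>]) (use t t2 in linarith)
  have r: "hs_le r (1648 * t\<^sup>2)" by (rule hs_le_mono[OF r]) (simp add: power2_eq_square)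
  define W where "W = unit4 + \<mu> + r"
  define \<omega> where "\<omega> = \<mu> + r"
  have W: "W = unit4 + \<omega>" by (simp add: W_def \<omega>_def add.assoc)
  have \<omega>: "hs_le \<omega> (9 * t)" unfolding \<omega>_def by (rule hs_le_mono[OF hs_le_add[OF \<mu> r]]) (use t t2 in linarith)
  let ?E = "unit4 :: (nat, nat \<times> nat, nat, nat \<times> nat) tensor"
  have E: "hs_le ?E 1" by (rule hs_le_unit)
  have W2: "hs_le W 2" unfolding W by (rule hs_le_mono[OF hs_le_add[OF E \<omega>]]) (use t in simp)
  define T where "T = vcon W W"
  have T_block: "block A = T" by (simp add: block_eq[OF A2] W_eq T_def W_def)
  have T: "nuclear T 4" unfolding T_def using nuclear_vcon[OF W2 W2] by simp
  \<comment> \<open>Splitting off the vacuum separates the terms designed to cancel \<open>P\<close>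
    from the actions of the disentangler on \<open>D\<close>, which gain an extra factor
    \<open>t\<close>.\<close>
  define D where "D = vcon \<omega> W + vcon ?E \<omega>"
  have T_eq: "T = unit4 + D"
  proof -
    have "T = vcon ?E W + vcon \<omega> W" unfolding T_def by (subst (1) W) (rule vcon_add_left[OF E \<omega> W2])
    also have "vcon ?E W = unit4 + vcon ?E \<omega>"
      unfolding W by (subst vcon_add_right[OF E E \<omega>]) (simp add: vcon_unit_unit)
    finally show ?thesis unfolding D_def by (simp only: ac_simps)
  qed
  have D: "nuclear D (27 * t)"
    unfolding D_def by (rule nuclear_mono[OF nuclear_add[OF nuclear_vcon[OF \<omega> W2] nuclear_vcon[OF E \<omega>]]]) simp
  define \<mu>p where "\<mu>p = \<mu> - bot0 \<mu>"
  define \<mu>q where "\<mu>q = \<mu> - top0 \<mu>"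
  define rp where "rp = r - bot0 r"
  define rq where "rq = r - top0 r"
  have cut: "hs_le \<mu>p (8 * t)" "hs_le \<mu>q (8 * t)" "hs_le rp (1648 * t\<^sup>2)" "hs_le rq (1648 * t\<^sup>2)"
    unfolding \<mu>p_def \<mu>q_def rp_def rq_def by (intro hs_le_diff_bot0 hs_le_diff_top0 \<mu> r)+
  have Wp: "W - bot0 W = \<mu>p + rp" "W - top0 W = \<mu>q + rq"
    by (auto simp: W_def \<mu>p_def rp_def \<mu>q_def rq_def bot0_def top0_def unit4_def fun_eq_iff)
  have \<mu>rq: "hs_le (\<mu>q + rq) (9 * t)" by (rule hs_le_mono[OF hs_le_add[OF cut(2,4)]]) (use t t2 in linarith)
  \<comment> \<open>The couplings of the upper to the lower row that the disentangler has to cancel.\<close>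
  define P where "P = vcon \<mu>p \<mu>q"
  define rem where "rem = vcon \<mu>p rq + vcon rp (\<mu>q + rq)"
  have T_cut: "T = vcon (bot0 W) (top0 W) + P + rem"
    unfolding T_def vcon_cut[OF W2 W2] Wp P_def rem_def vcon_add_left[OF cut(1,3) \<mu>rq] vcon_add_right[OF cut(1,2,4)]
    by (simp add: add.assoc)
  \<comment> \<open>Every term contains one second-order factor: 8 * 1648 + 1648 * 9 =
    28016.\<close>
  have rem: "nuclear rem (28016 * t ^ 3)"
    unfolding rem_def
    by (rule nuclear_mono[OF nuclear_add[OF nuclear_vcon[OF cut(1,4)] nuclear_vcon[OF cut(3) \<mu>rq]]])
       (simp add: power_numeral_reduce)
  have P: "nuclear P (64 * t\<^sup>2)"
    unfolding P_def by (rule nuclear_mono[OF nuclear_vcon[OF cut(1,2)]]) (simp add: power2_eq_square)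
  note Pb = nuclear_hs_le[OF P]
  \<comment> \<open>A nonzero bond value \<open>m\<close> uses up the only nonzero vertical leg of
    each row, so the outer legs \<open>j\<close> and \<open>l\<close> vanish. It also fixes on which
    of the two sites the perturbation sits, the same in both rows, and then the horizontal legs on
    the opposite side vanish in both rows.\<close>
  have P_supp: "j = 0 \<and> l = 0 \<and> (I = 0 \<or> K = 0)" if "P I j K l \<noteq> 0" for I j K l
  proof -
    have "\<exists>m. \<mu>p (fst I) j (fst K) m * \<mu>q (snd I) m (snd K) l \<noteq> 0"
      using that infsum_0[of UNIV "\<lambda>m. \<mu>p (fst I) j (fst K) m * \<mu>q (snd I) m (snd K) l"]
      unfolding P_def vcon_def by blast
    then obtain m where m: "\<mu>p (fst I) j (fst K) m \<noteq> 0" "\<mu>q (snd I) m (snd K) l \<noteq> 0" by auto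
    then have m': "m \<noteq> 0" "\<mu> (fst I) j (fst K) m \<noteq> 0" "\<mu> (snd I) m (snd K) l \<noteq> 0"
      by (auto simp: \<mu>p_def \<mu>q_def bot0_def top0_def split: if_splits)
    show ?thesis
      using m'(1) \<mu>_supp[OF m'(2)] \<mu>_supp[OF m'(3)]
      unfolding prod_eq_0_iff[of I] prod_eq_0_iff[of K] prod_eq_0_iff[of m] by blast
  qed
  \<comment> \<open>By its support, \<open>P\<close> is a row, a column and a corner. The shear
    cancels the row and the column; as it requires \<open>N\<close> and \<open>M\<close> to vanish
    at 0, the corner \<open>s\<close> is instead absorbed in the upper factor
    \<open>W0\<close>.\<close>
  define s where "s = P 0 0 0 0"
  define N where "N I = (if I = 0 then 0 else P I 0 0 0)" for I
  define M where "M K = (if K = 0 then 0 else P 0 0 K 0)" for K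
  define \<nu> where "\<nu> = (\<Sum>\<^sub>\<infinity>x. N x * M x)"
  have P_eq: "P = rowt N + colt M + scale4 s unit4"
  proof (intro ext)
    fix I j K l
    show "P I j K l = (rowt N + colt M + scale4 s unit4) I j K l"
      using P_supp[of I j K l]
      by (cases "j = 0 \<and> l = 0 \<and> (I = 0 \<or> K = 0)")
         (auto simp: rowt_def colt_def scale4_def unit4_def N_def M_def s_def)
  qed
  have N0: "N 0 = 0" and M0: "M 0 = 0" by (auto simp: N_def M_def)
  have N: "l2_le N (64 * t\<^sup>2)"
    by (rule l2_le_pullback[OF hs_le_slices(1)[OF Pb, of 0 0 0], where h = id]) (auto simp: N_def)
  have M: "l2_le M (64 * t\<^sup>2)"
    by (rule l2_le_pullback[OF hs_le_slices(3)[OF Pb, of 0 0 0], where h = id]) (auto simp: M_def)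
  have s: "\<bar>s\<bar> \<le> 64 * t\<^sup>2" unfolding s_def by (rule hs_le_entry[OF Pb])
  have \<nu>: "\<bar>\<nu>\<bar> \<le> 4096 * t ^ 4"
    using l2_le_inner_le[OF N M] by (simp add: \<nu>_def power_numeral_reduce mult_ac)
  have N_eq: "(rowt N :: (nat \<times> nat, nat, nat \<times> nat, nat) tensor) = rowt (\<lambda>I. P I 0 0 0) - scale4 s unit4"
    by (auto simp: rowt_def scale4_def unit4_def N_def s_def fun_eq_iff)
  have M_eq: "(colt M :: (nat \<times> nat, nat, nat \<times> nat, nat) tensor) = colt (\<lambda>K. P 0 0 K 0) - scale4 s unit4"
    by (auto simp: colt_def scale4_def unit4_def M_def s_def fun_eq_iff)
  have nN: "nuclear (rowt N :: (nat \<times> nat, nat, nat \<times> nat, nat) tensor) (128 * t\<^sup>2)"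
    unfolding N_eq by (rule nuclear_mono[OF nuclear_diff[OF nuclear_rowt[OF P] nuclear_scale[OF nuclear_unit]]]) (use s in simp)
  have nM: "nuclear (colt M :: (nat \<times> nat, nat, nat \<times> nat, nat) tensor) (128 * t\<^sup>2)"
    unfolding M_eq by (rule nuclear_mono[OF nuclear_diff[OF nuclear_colt[OF P] nuclear_scale[OF nuclear_unit]]]) (use s in simp)
  define g where "g = shear N M"
  define h where "h = shear_inv N M"
  have g: "nuclear (mat_tensor g) (257 * t\<^sup>2)"
    unfolding g_def mat_tensor_shear \<nu>_def[symmetric]
    by (rule nuclear_mono[OF nuclear_diff[OF nuclear_diff[OF nM nN] nuclear_scale[OF nuclear_unit]]]) (use \<nu> t42 t2 in linarith)
  have h: "nuclear (mat_tensor h) (257 * t\<^sup>2)"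
    unfolding h_def mat_tensor_shear_inv
  proof (rule nuclear_mono[OF nuclear_diff[OF nuclear_diff[OF nN nM] nuclear_Lact[OF nM]]])
    show "nuclear (mat_tensor (\<lambda>i j. if i = 0 then N j else 0)) (128 * t\<^sup>2)" using nN by (simp add: mat_tensor_row)
    have "128 * t\<^sup>2 * (128 * t\<^sup>2) = 16384 * t ^ 4" by (simp add: power_numeral_reduce)
    then show "128 * t\<^sup>2 + 128 * t\<^sup>2 + 128 * t\<^sup>2 * (128 * t\<^sup>2) \<le> 257 * t\<^sup>2" using t42 t2 by linarith
  qed
  note gb = nuclear_hs_le[OF g] and hb = nuclear_hs_le[OF h] and Tb = nuclear_hs_le[OF T] and Db = nuclear_hs_le[OF D]
  define Z where "Z = Lact g (Ract h T)"
  have Z: "nuclear Z (133 * t ^ 3)"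
    unfolding Z_def
  proof (rule nuclear_mono[OF nuclear_Lact[OF nuclear_Ract[OF T h] g]])
    have "257 * t\<^sup>2 * 4 * (257 * t\<^sup>2) = 264196 * t ^ 4" by (simp add: power_numeral_reduce)
    then show "257 * t\<^sup>2 * 4 * (257 * t\<^sup>2) \<le> 133 * t ^ 3" using t4 t3 by linarith
  qed
  have conj: "conjR (id_plus g) (id_plus h) T = T + Ract h T + (Lact g T + Z)"
    unfolding Z_def conjR_def by (intro ext) (simp only: conj_expand[OF Tb gb hb])
  have RT: "Ract h T = - colt M + Ract h D"
    unfolding T_eq Ract_add[OF hs_le_unit Db hb] by (simp add: h_def Ract_shear_inv_unit N0)
  have LT: "Lact g T = - rowt N - scale4 \<nu> unit4 + Lact g D"
    unfolding T_eq Lact_add[OF hs_le_unit Db gb] by (simp add: g_def Lact_shear_unit M0 \<nu>_def)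
  \<comment> \<open>Adding \<open>s\<close> to the upper factor multiplies it by all of
    \<open>top0 W\<close> rather than by the vacuum alone; \<open>tail\<close> measures the excess,
    which together with \<open>s\<close> is of third order.\<close>
  define tail where "tail = top0 W - unit4"
  have tail: "hs_le tail (9 * t)"
  proof -
    have "tail = top0 \<omega>" by (auto simp: tail_def W top0_def unit4_def fun_eq_iff)
    then show ?thesis using hs_le_top0[OF \<omega>] by simp
  qed
  \<comment> \<open>Every summand is at least of third order: the uncancelled couplings, the
    disentangler acting on \<open>D\<close>, its two-sided action on \<open>T\<close>, the
    normalization \<open>\<nu>\<close>, and the excess from the corner.\<close>
  define Rem where "Rem = rem + Ract h D + Lact g D + Z - scale4 \<nu> unit4 - scale4 s (vcon ?E tail)"
  have "nuclear Rem (28016 * t ^ 3 + 257 * t\<^sup>2 * (27 * t) + 27 * t * (257 * t\<^sup>2) + 133 * t ^ 3 + \<bar>\<nu>\<bar> * 1 + \<bar>s\<bar> * (1 * (9 * t)))"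
    unfolding Rem_def
    by (intro nuclear_diff nuclear_add rem nuclear_Ract nuclear_Lact D g h Z nuclear_scale nuclear_unit nuclear_vcon[OF E tail])
  then have Rem: "nuclear Rem (43000 * t ^ 3)"
  proof (rule nuclear_mono)
    have "\<bar>s\<bar> * (1 * (9 * t)) \<le> 64 * t\<^sup>2 * (1 * (9 * t))" by (intro mult_right_mono s) (use t0 in simp)
    moreover have "64 * t\<^sup>2 * (1 * (9 * t)) = 576 * t ^ 3" "257 * t\<^sup>2 * (27 * t) = 6939 * t ^ 3"
        "27 * t * (257 * t\<^sup>2) = 6939 * t ^ 3"
      by (simp_all add: power_numeral_reduce)
    ultimately show "28016 * t ^ 3 + 257 * t\<^sup>2 * (27 * t) + 27 * t * (257 * t\<^sup>2) + 133 * t ^ 3 + \<bar>\<nu>\<bar> * 1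
        + \<bar>s\<bar> * (1 * (9 * t)) \<le> 43000 * t ^ 3"
      using \<nu> t4 t3 by linarith
  qed
  define W0 where "W0 = bot0 W + scale4 s unit4"
  have S_eq: "conjR (id_plus g) (id_plus h) T = vcon W0 (top0 W) + Rem"
  proof -
    have e1: "vcon W0 (top0 W) = vcon (bot0 W) (top0 W) + scale4 s (vcon ?E (top0 W))"
      unfolding W0_def by (subst vcon_add_left[OF hs_le_bot0[OF W2] hs_le_scale[OF hs_le_unit] hs_le_top0[OF W2]])
        (simp add: vcon_scale_left)
    have "vcon ?E (top0 W) = unit4 + vcon ?E tail"
      using vcon_add_right[OF E E tail] by (simp add: vcon_unit_unit tail_def)
    then have e2: "scale4 s (vcon ?E (top0 W)) = scale4 s unit4 + scale4 s (vcon ?E tail)"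
      by (simp add: scale4_def fun_eq_iff distrib_left)
    have e3: "conjR (id_plus g) (id_plus h) T
        = vcon (bot0 W) (top0 W) + (rowt N + colt M + scale4 s unit4) + rem
          + (- colt M + Ract h D) + (- rowt N - scale4 \<nu> unit4 + Lact g D + Z)"
      unfolding conj RT LT by (subst T_cut, subst P_eq) (rule refl)
    show ?thesis unfolding Rem_def e1 e2 e3 by (intro ext) simp
  qed
  obtain X Y where X: "hs_le X (sqrt (43000 * t ^ 3))" and Y: "hs_le Y (sqrt (43000 * t ^ 3))"
    and XY: "Rem = vcon X (Y :: (nat, nat, nat, nat \<times> nat) tensor)"
    using Rem by (auto simp: nuclear_def)
  have sq: "sqrt (43000 * t ^ 3) \<le> 208 * sqrt (t ^ 3)"
  proof -
    have "sqrt 43000 \<le> 208" by (rule real_le_lsqrt) auto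
    then show ?thesis using t3 by (simp add: real_sqrt_mult mult_right_mono)
  qed
  \<comment> \<open>Bond value 0 receives the rows, split into the first-order part
    (\<open>\<alpha>\<close>, \<open>\<alpha>'\<close>) and the rest; the corner correction
    \<open>s\<close> goes only into the upper factor. Positive bond values receive \<open>X\<close>
    and \<open>Y\<close>, whence the index \<open>m - 1\<close>.\<close>
  define \<alpha> where "\<alpha> = (\<lambda>i j k m. if m = (0::nat) then \<mu> i j k 0 else 0)"
  define \<alpha>' where "\<alpha>' = (\<lambda>i m k l. if m = (0::nat) then \<mu> i 0 k l else 0)"
  define \<beta>0 where "\<beta>0 = (\<lambda>i j k m. if m = (0::nat) then (r + scale4 s unit4) i j k 0 else 0)"
  define \<beta>0' where "\<beta>0' = (\<lambda>i m k l. if m = (0::nat) then r i 0 k l else 0)"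
  define \<beta>1 where "\<beta>1 = (\<lambda>i j k m. if m = 0 then 0 else X i j k (m - 1))"
  define \<beta>1' where "\<beta>1' = (\<lambda>i m k l. if m = 0 then 0 else Y i (m - 1) k l)"
  have \<alpha>: "hs_le \<alpha> (8 * t)"
    by (rule hs_le_pullback[OF \<mu>, of "\<lambda>(i, j, k, m). (i, j, k, 0)"]) (auto simp: \<alpha>_def inj_on_def split: if_splits)
  have \<alpha>': "hs_le \<alpha>' (8 * t)"
    by (rule hs_le_pullback[OF \<mu>, of "\<lambda>(i, m, k, l). (i, 0, k, l)"]) (auto simp: \<alpha>'_def inj_on_def split: if_splits)
  have rs: "hs_le (r + scale4 s unit4) (1712 * t\<^sup>2)"
    by (rule hs_le_mono[OF hs_le_add[OF r hs_le_scale[OF hs_le_unit]]]) (use s in simp)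
  have \<beta>0: "hs_le \<beta>0 (1712 * t\<^sup>2)"
    by (rule hs_le_pullback[OF rs, of "\<lambda>(i, j, k, m). (i, j, k, 0)"]) (auto simp: \<beta>0_def inj_on_def split: if_splits)
  have \<beta>0': "hs_le \<beta>0' (1648 * t\<^sup>2)"
    by (rule hs_le_pullback[OF r, of "\<lambda>(i, m, k, l). (i, 0, k, l)"]) (auto simp: \<beta>0'_def inj_on_def split: if_splits)
  have \<beta>1: "hs_le \<beta>1 (sqrt (43000 * t ^ 3))"
    by (rule hs_le_pullback[OF X, of "\<lambda>(i, j, k, m). (i, j, k, m - 1)"]) (auto simp: \<beta>1_def inj_on_def split: if_splits)
  have \<beta>1': "hs_le \<beta>1' (sqrt (43000 * t ^ 3))"
    by (rule hs_le_pullback[OF Y, of "\<lambda>(i, m, k, l). (i, m - 1, k, l)"]) (auto simp: \<beta>1'_def inj_on_def split: if_splits)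
  \<comment> \<open>The second-order part is at most 1712 times \<open>sqrt (t ^ 3)\<close> because
    \<open>t\<^sup>2\<close> is bounded by that root, and the factor \<open>X\<close> contributes at
    most 208 times it.\<close>
  have \<beta>: "hs_le (\<beta>0 + \<beta>1) (2000 * sqrt (t ^ 3))"
    by (rule hs_le_mono[OF hs_le_add[OF \<beta>0 \<beta>1]]) (use q sq t2 real_sqrt_ge_zero[OF t3] in linarith)
  have \<beta>': "hs_le (\<beta>0' + \<beta>1') (2000 * sqrt (t ^ 3))"
    by (rule hs_le_mono[OF hs_le_add[OF \<beta>0' \<beta>1']]) (use q sq t2 real_sqrt_ge_zero[OF t3] in linarith)
  define Su where "Su = unit4 + \<alpha> + (\<beta>0 + \<beta>1)"
  define Sd where "Sd = unit4 + \<alpha>' + (\<beta>0' + \<beta>1')"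
  have Su: "Su i j k 0 = W0 i j k 0" "Su i j k (Suc n) = X i j k n" for i j k n
    by (auto simp: Su_def W0_def bot0_def W_def \<alpha>_def \<beta>0_def \<beta>1_def unit4_def)
  have Sd: "Sd i 0 k l = W i 0 k l" "Sd i (Suc n) k l = Y i n k l" for i k l n
    by (auto simp: Sd_def W_def \<alpha>'_def \<beta>0'_def \<beta>1'_def unit4_def)
  have W0: "W0 = bot0 W0" by (auto simp: W0_def bot0_def scale4_def unit4_def fun_eq_iff)
  have "vcon Su Sd = vcon (bot0 W0) (top0 W) + vcon X Y"
    using vcon_zero_Suc[OF hs_le_add[OF hs_le_add[OF hs_le_unit \<alpha>] \<beta>] hs_le_add[OF hs_le_add[OF hs_le_unit \<alpha>'] \<beta>'], folded Su_def Sd_def]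
    by (simp add: Su Sd vcon_bot0_top0)
  then have fact: "conjR (id_plus g) (id_plus h) (block A) = vcon Su Sd"
    using S_eq W0 XY T_block by simp
  \<comment> \<open>With the bond leg at 0, an entry of \<open>\<mu>\<close> with exactly one
    nonzero vertical leg must have a nonzero outer leg.\<close>
  have "\<alpha> i 0 k m = 0" for i k m using \<mu>_supp(1)[of i 0 k 0] by (auto simp: \<alpha>_def)
  moreover have "\<alpha>' i m k 0 = 0" for i k m using \<mu>_supp(1)[of i 0 k 0] by (auto simp: \<alpha>'_def)
  ultimately show ?thesis
    by (rule that[OF shear_id_plus_inv_pair[OF N N0 M M0, folded g_def h_def] fact Su_def \<alpha> \<beta> _ Sd_def \<alpha>' \<beta>'])
qed

section \<open>The type II step\<close>

text \<open>The legs now contracted are the outer legs of the factors. The vacuum forces value 0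
  there, where \<open>\<alpha>\<close> and \<open>\<alpha>'\<close> vanish, so every first-order
  term disappears and only their mutual product, of order \<open>t\<^sup>2\<close>, remains beside
  the \<open>\<beta>\<close> terms.\<close>

lemma (in leg_isometry) typeII_step:
  assumes Su: "Su = unit4 + \<alpha> + \<beta>" and \<alpha>: "hs_le \<alpha> (8 * t)" and \<beta>: "hs_le \<beta> (2000 * q)" and \<alpha>0: "\<And>i k m. \<alpha> i 0 k m = 0"
    and Sd: "Sd = unit4 + \<alpha>' + \<beta>'" and \<alpha>': "hs_le \<alpha>' (8 * t)" and \<beta>': "hs_le \<beta>' (2000 * q)" and \<alpha>'0: "\<And>i m k. \<alpha>' i m k 0 = 0"
    and t: "t \<le> 1 / 2000" and tq: "t\<^sup>2 \<le> q" and q: "q \<le> 1 / 40000"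
  obtains r where "typeII J Su Sd = unit4 + r" "hs_le r (8100 * q)"
proof -
  have E: "hs_le (unit4 :: (nat, nat, nat, nat \<times> nat) tensor) 1" "hs_le (unit4 :: (nat, nat \<times> nat, nat, nat) tensor) 1"
    by (rule hs_le_unit)+
  have Su2: "hs_le Su 2" unfolding Su by (rule hs_le_mono[OF hs_le_add[OF hs_le_add[OF E(2) \<alpha>] \<beta>]]) (use t q in simp)
  have E\<alpha>': "hs_le (unit4 + \<alpha>') 2" by (rule hs_le_mono[OF hs_le_add[OF E(1) \<alpha>']]) (use t in simp)
  have E\<alpha>: "hs_le (unit4 + \<alpha>) (1 + 8 * t)" by (rule hs_le_add[OF E(2) \<alpha>])
  define r where "r = vcon \<alpha>' \<alpha> + vcon (unit4 + \<alpha>') \<beta> + vcon \<beta>' Su"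
  have z: "vcon unit4 \<alpha> = 0" "vcon \<alpha>' unit4 = 0"
    by (intro ext; simp add: vcon_unit_left vcon_unit_right \<alpha>0 \<alpha>'0)+
  have "vcon Sd Su = vcon (unit4 + \<alpha>') Su + vcon \<beta>' Su"
    unfolding Sd by (rule vcon_add_left[OF E\<alpha>' \<beta>' Su2])
  also have "vcon (unit4 + \<alpha>') Su = vcon (unit4 + \<alpha>') (unit4 + \<alpha>) + vcon (unit4 + \<alpha>') \<beta>"
    unfolding Su by (rule vcon_add_right[OF E\<alpha>' E\<alpha> \<beta>])
  also have "vcon (unit4 + \<alpha>') (unit4 + \<alpha>) = unit4 + vcon \<alpha>' \<alpha>"
    by (simp only: vcon_add_left[OF E(1) \<alpha>' E\<alpha>] vcon_add_right[OF E \<alpha>] vcon_add_right[OF \<alpha>' E(2) \<alpha>] z vcon_unit_unit add_0 add_0_right)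
  finally have U: "vcon Sd Su = unit4 + r" unfolding r_def by (simp only: ac_simps)
  have r: "hs_le r (8100 * q)"
    unfolding r_def
  proof (rule hs_le_mono[OF hs_le_add[OF hs_le_add[OF hs_le_vcon[OF \<alpha>' \<alpha>] hs_le_vcon[OF E\<alpha>' \<beta>]] hs_le_vcon[OF \<beta>' Su2]]])
    \<comment> \<open>Bounding \<open>t\<^sup>2\<close> by \<open>q\<close>, the total is 64 + 4000
      + 4000 times \<open>q\<close>.\<close>
    have "8 * t * (8 * t) = 64 * t\<^sup>2" by (simp add: power2_eq_square)
    then show "8 * t * (8 * t) + 2 * (2000 * q) + 2000 * q * 2 \<le> 8100 * q"
      using tq hs_le_nonneg[OF \<beta>] by linarith
  qed
  show ?thesis
  proof (rule that)
    show "typeII J Su Sd = unit4 + push2 r"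
      unfolding typeII_eq U by (subst push2_add[OF hs_le_unit r]) (simp add: push2_unit)
    show "hs_le (push2 r) (8100 * q)" by (rule hs_le_push2[OF r])
  qed
qed

text \<open>The normalizing entry \<open>a\<close> lies within \<open>d\<close> of 1, so
  \<open>1 / a\<close> is at most 2, while the numerator \<open>r + scale4 (1 - a) unit4\<close> has
  norm at most \<open>2 * d\<close>.\<close>

lemma normalize_perturbed_unit:
  fixes r :: tensor4
  assumes A: "A = unit4 + r" and r: "hs_le r d" and d: "d \<le> 1 / 2"
  shows "A 0 0 0 0 \<noteq> 0" "hs_le (tdiff (\<lambda>i j k l. A i j k l / A 0 0 0 0) Astar) (4 * d)"
proof -
  define a where "a = A 0 0 0 0"
  have a: "\<bar>a - 1\<bar> \<le> d" using hs_le_entry[OF r, of 0 0 0 0] by (simp add: a_def A unit4_def)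
  then have a2: "1 / 2 \<le> a" using d by linarith
  then show "A 0 0 0 0 \<noteq> 0" by (auto simp: a_def[symmetric])
  have "tdiff (\<lambda>i j k l. A i j k l / A 0 0 0 0) Astar = scale4 (1 / a) (r + scale4 (1 - a) unit4)"
    unfolding a_def[symmetric]
    using a2 by (auto simp: tdiff_def Astar_def A scale4_def unit4_def fun_eq_iff field_simps)
  moreover have "hs_le (scale4 (1 / a) (r + scale4 (1 - a) unit4)) (\<bar>1 / a\<bar> * (d + \<bar>1 - a\<bar> * 1))"
    by (intro hs_le_scale hs_le_add r hs_le_unit)
  moreover have "\<bar>1 / a\<bar> * (d + \<bar>1 - a\<bar> * 1) \<le> 2 * (2 * d)"
    by (rule mult_mono) (use a a2 in \<open>auto simp: field_simps\<close>)
  ultimately show "hs_le (tdiff (\<lambda>i j k l. A i j k l / A 0 0 0 0) Astar) (4 * d)"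
    using hs_le_mono by fastforce
qed

section \<open>Composition of the gauge, type I and type II steps\<close>

theorem theorem1:
  fixes J :: "(nat \<times> nat) \<Rightarrow> nat \<Rightarrow> real"
  assumes "isometric_iso J"
    and "\<And>a b. J (a,b) 0 = (if a = 0 \<and> b = 0 then 1 else 0)"
  shows "\<exists>C \<delta>0. C > 0 \<and> \<delta>0 > 0 \<and>
    (\<forall>A :: tensor4. hs4 A \<and> A 0 0 0 0 = 1 \<and> hsnorm4 (tdiff A Astar) \<le> \<delta>0 \<longrightarrow>
      (\<exists>Gh Ghi Gv Gvi R Ri Su Sd.
         bounded_inv_pair Gh Ghi \<and> bounded_inv_pair Gv Gvi \<and> bounded_inv_pair R Ri \<and>
         hs4 Su \<and> hs4 Sd \<and>
         factor_cond (conjR R Ri (block (typeI J (gauge Gh Ghi Gv Gvi A)))) Su Sd \<and>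
         (let A3 = typeII J Su Sd;
              A' = (\<lambda>i j k l. A3 i j k l / A3 0 0 0 0)
          in A3 0 0 0 0 \<noteq> 0 \<and> A' 0 0 0 0 = 1 \<and>
             hsnorm4 (tdiff A' Astar) \<le> C * hsnorm4 (tdiff A Astar) powr (3/2))))"
proof -
  interpret leg_isometry J
  proof
    show "orthonormal_family (\<lambda>p I. J I p)" by (rule isometric_iso_orthonormal[OF assms(1)])
    show "J I 0 = of_bool (I = 0)" for I by (cases I) (simp add: assms(2) zero_prod_def)
  qed
  \<comment> \<open>The constant 32400 is 4 * 8100: the error of the type II step followed by the
    loss in the normalization.\<close>
  have "\<exists>Gh Ghi Gv Gvi R Ri Su Sd.
         bounded_inv_pair Gh Ghi \<and> bounded_inv_pair Gv Gvi \<and> bounded_inv_pair R Ri \<and>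
         hs4 Su \<and> hs4 Sd \<and>
         factor_cond (conjR R Ri (block (typeI J (gauge Gh Ghi Gv Gvi A)))) Su Sd \<and>
         (let A3 = typeII J Su Sd;
              A' = (\<lambda>i j k l. A3 i j k l / A3 0 0 0 0)
          in A3 0 0 0 0 \<noteq> 0 \<and> A' 0 0 0 0 = 1 \<and>
             hsnorm4 (tdiff A' Astar) \<le> 32400 * hsnorm4 (tdiff A Astar) powr (3/2))"
    if A: "hs4 A" "A 0 0 0 0 = 1" and small: "hsnorm4 (tdiff A Astar) \<le> 1 / 2000" for A :: tensor4
  proof -
    define t where "t = hsnorm4 (tdiff A Astar)"
    have t: "t \<le> 1 / 2000" using small by (simp add: t_def)
    define B where "B = A - unit4"
    have B_eq: "tdiff A Astar = B"
      by (auto simp: B_def tdiff_def Astar_def unit4_def fun_eq_iff)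
    \<comment> \<open>An infinite sum that diverges has value 0, so smallness of
      \<open>hsnorm4\<close> alone says nothing. Summability of \<open>B\<close> is first derived
      from that of \<open>A\<close>; only then is \<open>t\<close> a genuine norm bound.\<close>
    have "hs_le A (hsnorm4 A)" using A(1) by (simp add: hs_le_iff)
    then have "hs_le B (hsnorm4 A + 1)" unfolding B_def by (rule hs_le_diff[OF _ hs_le_unit])
    then have B: "hs_le B t" unfolding t_def B_eq by (simp add: hs_le_iff)
    have t0: "0 \<le> t" by (rule hs_le_nonneg[OF B])
    have B0: "B 0 0 0 0 = 0" and AB: "A = unit4 + B" using A(2) by (auto simp: B_def unit4_def)
    define q where "q = sqrt (t ^ 3)"
    have t3: "t ^ 3 \<le> (1 / 2000) ^ 3" by (rule power_mono[OF t t0])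
    have q_le: "q \<le> 1 / 40000"
      unfolding q_def by (rule real_le_lsqrt) (use t0 t3 in \<open>auto simp: power_divide\<close>)
    have tq: "t\<^sup>2 \<le> q"
      unfolding q_def
    proof (rule real_le_rsqrt)
      have "t ^ 3 * t \<le> t ^ 3 * 1" by (rule mult_left_mono) (use t t0 in auto)
      then show "(t\<^sup>2)\<^sup>2 \<le> t ^ 3" by (simp add: power_numeral_reduce mult_ac)
    qed
    have q_powr: "q = t powr (3/2)"
    proof (cases "t = 0")
      case False
      then have "t > 0" using t0 by simp
      then have "t powr (3/2) = (t powr 3) powr (1/2)" by (simp add: powr_powr del: powr_numeral)
      also have "t powr 3 = t ^ 3" using \<open>t > 0\<close> powr_realpow[of t 3] by simp
      also have "(t ^ 3) powr (1/2) = q" using t0 by (simp add: q_def powr_half_sqrt)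
      finally show ?thesis by simp
    qed (simp add: q_def)
    obtain Gh Ghi Gv Gvi \<kappa>1 \<rho>1 where G: "bounded_inv_pair Gh Ghi" "bounded_inv_pair Gv Gvi"
      and 1: "gauge Gh Ghi Gv Gvi A = unit4 + \<kappa>1 + \<rho>1" "hs_le \<kappa>1 t" "hs_le \<rho>1 (25 * t\<^sup>2)"
        "\<And>i k. \<kappa>1 i 0 k 0 \<noteq> 0 \<Longrightarrow> i \<noteq> 0 \<and> k \<noteq> 0"
      by (rule gauge_step[OF B _ B0 AB]) (use t in auto)
    obtain \<kappa>2 \<rho>2 where 2: "typeI J (gauge Gh Ghi Gv Gvi A) = unit4 + \<kappa>2 + \<rho>2" "hs_le \<kappa>2 (4 * t)" "hs_le \<rho>2 (408 * t\<^sup>2)"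
        "\<And>i j k l. \<kappa>2 i j k l \<noteq> 0 \<Longrightarrow> (i = 0 \<or> k = 0) \<and> (j = 0 \<longleftrightarrow> l \<noteq> 0)"
      by (rule typeI_step[OF 1(1,2,3) _ 1(4)]) (use t in auto)
    obtain R Ri \<alpha> \<beta> \<alpha>' \<beta>' and Su :: "(nat, nat \<times> nat, nat, nat) tensor" and Sd where R: "bounded_inv_pair R Ri"
      and S: "conjR R Ri (block (typeI J (gauge Gh Ghi Gv Gvi A))) = vcon Su Sd"
      and Su: "Su = unit4 + \<alpha> + \<beta>" "hs_le \<alpha> (8 * t)" "hs_le \<beta> (2000 * q)" "\<And>i k m. \<alpha> i 0 k m = 0"
      and Sd: "Sd = unit4 + \<alpha>' + \<beta>'" "hs_le \<alpha>' (8 * t)" "hs_le \<beta>' (2000 * q)" "\<And>i m k. \<alpha>' i m k 0 = 0"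
      by (rule factorization_step[OF 2(1,2,3) t 2(4), folded q_def]) (assumption, rule that)
    obtain r where r: "typeII J Su Sd = unit4 + r" "hs_le r (8100 * q)"
      by (rule typeII_step[OF Su Sd t tq q_le])
    have "8100 * q \<le> 1 / 2" using q_le by simp
    note A3 = normalize_perturbed_unit[OF r this]
    have hs: "hs4 Su" "hs4 Sd"
      using hs_le_add[OF hs_le_add[OF hs_le_unit Su(2)] Su(3)] hs_le_add[OF hs_le_add[OF hs_le_unit Sd(2)] Sd(3)]
      by (simp_all add: Su(1) Sd(1) hs_le_iff)
    have "hsnorm4 (tdiff (\<lambda>i j k l. typeII J Su Sd i j k l / typeII J Su Sd 0 0 0 0) Astar) \<le> 32400 * t powr (3/2)"
      using A3(2) by (simp add: hs_le_iff q_powr)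
    then show ?thesis
      using G R hs S A3(1) unfolding Let_def factor_cond_iff t_def
      by (intro exI[of _ Gh] exI[of _ Ghi] exI[of _ Gv] exI[of _ Gvi] exI[of _ R] exI[of _ Ri] exI[of _ Su] exI[of _ Sd] conjI) auto
  qed
  then show ?thesis
    by (intro exI[of _ "32400 :: real"] exI[of _ "1 / 2000 :: real"]) auto
qed

end
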